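(* Let $H$ be a formal Hamiltonian as in the context, with alphabet $\Omega=\Omega(H)$. The trimmed form of $X_H$, i.e. the limit $X_{\mathrm{tram}}=\lim_{k\to\infty}X^{(k)}$ of the simplification procedure $X^{(0)}=X_H$, $X^{(k+1)}=\mathrm{simp}(X^{(k)})$, is given by $$X_{\mathrm{tram}}=X_{\mathrm{lin}}+\sum_{\boldsymbol\omega\in\Omega^*}\mathrm{Tram}^{\boldsymbol\omega}\,\mathfrak{D}_{\boldsymbol\omega},$$ where $\mathrm{Tram}^\emptyset=0$ and, for a word $\boldsymbol\omega\in\Omega^*$ of length $r\ge1$, $$\mathrm{Tram}^{\boldsymbol\omega}=\big((\mathrm{Sam}^\bullet)^{\circ r}\big)^{\boldsymbol\omega},$$ $(\mathrm{Sam}^\bullet)^{\circ r}$ being the composition of $r$ copies of the mould $\mathrm{Sam}^\bullet$.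
   Context: Formal Hamiltonians. Let $\nu\ge 1$, $\lambda=(\lambda_1,\dots,\lambda_\nu)\in\mathbb{C}^\nu$, and consider a formal power series in $(x,y)=(x_1,\dots,x_\nu,y_1,\dots,y_\nu)$ $$H(x,y)=\sum_{i=1}^\nu\lambda_i x_iy_i+\sum_{(n,m)\in A(H)}a_{nm}x^ny^m,\qquad a_{nm}\in\mathbb{C},$$ where $A(H)\subset\{(n,m)\in\mathbb{N}^\nu\times\mathbb{N}^\nu:\ |n|+|m|\ge 3\}$ (coefficients $a_{nm}$ are allowed to be zero). The Hamiltonian vector field of a formal series $G$ is the derivation $X_G=\sum_{i=1}^\nu\left(\frac{\partial G}{\partial x_i}\partial_{y_i}-\frac{\partial G}{\partial y_i}\partial_{x_i}\right)$ of $\mathbb{C}[[x,y]]$. Put $X_{\mathrm{lin}}=-\sum_i\lambda_ix_i\partial_{x_i}+\sum_i\lambda_iy_i\partial_{y_i}$. Alphabet. For $(n,m)\in\mathbb{N}^\nu\times\mathbb{N}^\nu$ let $\omega(n,m)=\sum_{j=1}^\nu\lambda_j(m_j-n_j)$, and $\Omega=\Omega(H)=\{\omega(n,m):(n,m)\in A(H)\}\subset\mathbb{C}$. The alphabet $\Omega$ is assumed to be a semigroup for addition (closed under addition). For a formal Hamiltonian $G=\sum_i\lambda_ix_iy_i+\sum_{|n|+|m|\ge3}g_{nm}x^ny^m$ and $\omega\in\mathbb{C}$, put $G_\omega=\sum_{|n|+|m|\ge3,\ \omega(n,m)=\omega}g_{nm}x^ny^m$. For $\omega\in\Omega$ put $\mathfrak{D}_\omega=X_{H_\omega}$,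 so that $X_H=X_{\mathrm{lin}}+\sum_{\omega\in\Omega}\mathfrak{D}_\omega$. Simplification. For a formal Hamiltonian $G=\sum_i\lambda_ix_iy_i+\sum_{|n|+|m|\ge3}g_{nm}x^ny^m$ (with $g_{nm}\in\mathbb{C}$) whose nonzero components $G_\omega$ all have $\omega\in\Omega$, $$\mathrm{simp}(X_G)=\exp\Big(\sum_{\omega\in\Omega,\ \omega\ne0}\tfrac1\omega X_{G_\omega}\Big)\,X_G\,\exp\Big(-\sum_{\omega\in\Omega,\ \omega\ne0}\tfrac1\omega X_{G_\omega}\Big)$$ (composition of operators on $\mathbb{C}[[x,y]]$); it is again the Hamiltonian vector field of a formal Hamiltonian of the same type, so $\mathrm{simp}$ can be iterated. All infinite sums and limits of operators are taken in the $(x,y)$-adic topology (applied to any element of $\mathbb{C}[[x,y]]$). Words and moulds. $\Omega^*$ is the set of finite words on $\Omega$, including the empty word $\emptyset$; $\ell(\boldsymbol\omega)$ is the length of a word. For $\boldsymbol{\omega}=\omega_1\cdots\omega_r$, $\|\boldsymbol{\omega}\|=\omega_1+\dots+\omega_r\in\Omega$ and $\mathfrak{D}_{\boldsymbol\omega}=\mathfrak{D}_{\omega_1}\circ\cdots\circ\mathfrak{D}_{\omega_r}$. A mould is a map $M^\bullet:\Omega^*\to\mathbb{C}$, $\boldsymbol\omega\mapsto M^{\boldsymbol\omega}$. The product is $(M^\bullet\times N^\bullet)^{\boldsymbol\omega}=\sum_{\boldsymbol\omega^1\boldsymbol\omega^2=\boldsymbol\omega}M^{\boldsymbol\omega^1}N^{\boldsymbol\omega^2}$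 (sum over all factorizations into two possibly empty words). The composition is $(M^\bullet\circ N^\bullet)^\emptyset=M^\emptyset$ and, for $\boldsymbol\omega\ne\emptyset$, $$(M^\bullet\circ N^\bullet)^{\boldsymbol\omega}=\sum_{k=1}^{\ell(\boldsymbol\omega)}\ \sum_{\boldsymbol\omega^1\cdots\boldsymbol\omega^k=\boldsymbol\omega,\ \boldsymbol\omega^i\ne\emptyset}M^{\|\boldsymbol\omega^1\|\cdots\|\boldsymbol\omega^k\|}\,N^{\boldsymbol\omega^1}\cdots N^{\boldsymbol\omega^k},$$ where $\|\boldsymbol\omega^1\|\cdots\|\boldsymbol\omega^k\|$ is the word of length $k$ with these letters. Further, $\mathrm{Exp}\,M^\bullet=\sum_{k\ge0}\frac1{k!}(M^\bullet)^{\times k}$ with $(M^\bullet)^{\times 0}$ the unit for the product, and $(\nabla M^\bullet)^{\boldsymbol\omega}=\|\boldsymbol\omega\|M^{\boldsymbol\omega}$ (with $\|\emptyset\|=0$). $I^\bullet$ is the mould equal to $1$ on words of length $1$ and $0$ otherwise. $V^\bullet$ is the mould with $V^{\boldsymbol\omega}=1/\omega$ if $\boldsymbol\omega=\omega$ has length $1$ and $\omega\ne0$, and $V^{\boldsymbol\omega}=0$ otherwise. The mould $\mathrm{Sam}^\bullet$ is $$\mathrm{Sam}^\bullet=\mathrm{Exp}\,V^\bullet\times I^\bullet\times\mathrm{Exp}(-V^\bullet)-\nabla(\mathrm{Exp}\,V^\bullet)\times\mathrm{Exp}(-V^\bullet).$$ *)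

theory Defs
  imports "HOL-Analysis.Analysis"
begin

section \<open>Formal power series in \<open>x\<^sub>1,\<dots>,x\<^sub>\<nu>,y\<^sub>1,\<dots>,y\<^sub>\<nu>\<close>\<close>

text \<open>
  The index type \<open>'v\<close> plays the role of \<open>{1,\<dots>,\<nu>}\<close>. An exponent \<open>(n, m)\<close> stands for the
  monomial \<open>x\<^sup>n y\<^sup>m\<close>; addition of exponents is componentwise.
\<close>

type_synonym 'v expo = "(nat^'v) \<times> (nat^'v)"

typedef (overloaded) ('v::finite) xyseries = "UNIV :: ('v expo \<Rightarrow> complex) set"
  morphisms xycoeff Abs_xyseries by simp

setup_lifting type_definition_xyseries

lemma xyseries_eqI: "(\<And>k. xycoeff F k = xycoeff G k) \<Longrightarrow> F = G"
  by transfer auto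

definition mdeg :: "'v::finite expo \<Rightarrow> nat" where
  "mdeg k = (\<Sum>i\<in>UNIV. fst k $ i) + (\<Sum>i\<in>UNIV. snd k $ i)"

lemma finite_vec_le: "finite {n :: nat^'v::finite. \<forall>i. n $ i \<le> N $ i}"
proof -
  have "finite (vec_nth -` (PiE UNIV (\<lambda>i. {..N $ i})))"
    by (intro finite_vimageI finite_PiE) (auto simp: inj_def vec_eq_iff)
  moreover have "{n :: nat^'v. \<forall>i. n $ i \<le> N $ i} = vec_nth -` (PiE UNIV (\<lambda>i. {..N $ i}))"
    by (auto simp: PiE_def Pi_def)
  ultimately show ?thesis by simp
qed

lemma finite_expo_split: "finite {(p, q). p + q = (k :: 'v::finite expo)}"
proof (rule finite_subset)
  let ?B = "{n :: nat^'v. \<forall>i. n $ i \<le> fst k $ i} \<times> {n :: nat^'v. \<forall>i. n $ i \<le> snd k $ i}"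
  show "finite (?B \<times> ?B)" by (intro finite_cartesian_product finite_vec_le)
  show "{(p, q). p + q = k} \<subseteq> ?B \<times> ?B" by auto
qed

instantiation xyseries :: (finite) comm_ring_1
begin

lift_definition zero_xyseries :: "'a xyseries" is "\<lambda>_. 0" .
lift_definition one_xyseries :: "'a xyseries" is "\<lambda>k. if k = 0 then 1 else 0" .
lift_definition plus_xyseries :: "'a xyseries \<Rightarrow> 'a xyseries \<Rightarrow> 'a xyseries" is "\<lambda>F G k. F k + G k" .
lift_definition minus_xyseries :: "'a xyseries \<Rightarrow> 'a xyseries \<Rightarrow> 'a xyseries" is "\<lambda>F G k. F k - G k" .
lift_definition uminus_xyseries :: "'a xyseries \<Rightarrow> 'a xyseries" is "\<lambda>F k. - F k" .
lift_definition times_xyseries :: "'a xyseries \<Rightarrow> 'a xyseries \<Rightarrow> 'a xyseries"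
  is "\<lambda>F G k. \<Sum>(p, q) | p + q = k. F p * G q" .

instance
proof
  fix F G H :: "'a xyseries"
  show "F + G + H = F + (G + H)" by transfer (simp add: algebra_simps)
  show "F + G = G + F" by transfer (simp add: algebra_simps)
  show "0 + F = F" by transfer simp
  show "- F + F = 0" by transfer simp
  show "F - G = F + - G" by transfer simp
  show "(0::'a xyseries) \<noteq> 1" by transfer (metis zero_neq_one)
  show "(F + G) * H = F * H + G * H"
    by transfer (simp add: algebra_simps sum.distrib case_prod_unfold)
  show "F * G = G * F"
  proof (transfer, rule ext)
    fix F G :: "'a expo \<Rightarrow> complex" and k
    show "(\<Sum>(p, q) | p + q = k. F p * G q) = (\<Sum>(p, q) | p + q = k. G p * F q)"
      by (rule sum.reindex_bij_witness[where i = prod.swap and j = prod.swap])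
        (auto simp: add.commute)
  qed
  show "1 * F = F"
  proof (transfer, rule ext)
    fix F :: "'a expo \<Rightarrow> complex" and k
    have "(\<Sum>(p, q) | p + q = k. (if p = 0 then 1 else 0) * F q) = (\<Sum>(p, q) \<in> {(0 :: 'a expo, k)}. F q)"
      by (rule sum.mono_neutral_cong_right[OF finite_expo_split]) (auto simp: zero_prod_def split: if_splits)
    then show "(\<Sum>(p, q) | p + q = k. (if p = 0 then 1 else 0) * F q) = F k" by simp
  qed
  show "F * G * H = F * (G * H)"
  proof (transfer, rule ext)
    fix F G H :: "'a expo \<Rightarrow> complex" and k
    let ?S = "\<lambda>k. {(p, q). p + q = (k :: 'a expo)}"
    have "(\<Sum>(p, c) | p + c = k. (\<Sum>(a, b) | a + b = p. F a * G b) * H c) =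
          (\<Sum>u\<in>?S k. \<Sum>v\<in>?S (fst u). F (fst v) * G (snd v) * H (snd u))"
      by (simp add: case_prod_unfold sum_distrib_right)
    also have "\<dots> = (\<Sum>(u, v)\<in>Sigma (?S k) (\<lambda>u. ?S (fst u)). F (fst v) * G (snd v) * H (snd u))"
      by (subst sum.Sigma) (auto simp: finite_expo_split)
    also have "\<dots> = (\<Sum>(u, v)\<in>Sigma (?S k) (\<lambda>u. ?S (snd u)). F (fst u) * (G (fst v) * H (snd v)))"
      by (rule sum.reindex_bij_witness[where
            i = "\<lambda>((a, t), (b, c)). ((a + b, c), (a, b))" and
            j = "\<lambda>((s, c), (a, b)). ((a, b + c), (b, c))"])
        (auto simp: algebra_simps)
    also have "\<dots> = (\<Sum>u\<in>?S k. \<Sum>v\<in>?S (snd u). F (fst u) * (G (fst v) * H (snd v)))"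
      by (subst sum.Sigma) (auto simp: finite_expo_split)
    also have "\<dots> = (\<Sum>(a, t) | a + t = k. F a * (\<Sum>(b, c) | b + c = t. G b * H c))"
      by (simp add: case_prod_unfold sum_distrib_left)
    finally show "(\<Sum>(p, c) | p + c = k. (\<Sum>(a, b) | a + b = p. F a * G b) * H c) =
        (\<Sum>(a, t) | a + t = k. F a * (\<Sum>(b, c) | b + c = t. G b * H c))" .
  qed
qed

end

lift_definition xyscale :: "complex \<Rightarrow> 'v::finite xyseries \<Rightarrow> 'v xyseries" (infixr "*\<^sub>c" 75)
  is "\<lambda>c F k. c * F k" .

text \<open>
  The topology is the \<open>(x, y)\<close>-adic one: a basic neighbourhood of \<open>F\<close> consists of the series that
  agree with \<open>F\<close> in all total degrees below some \<open>N\<close>.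
\<close>

instantiation xyseries :: (finite) t2_space
begin

definition open_xyseries :: "'a xyseries set \<Rightarrow> bool" where
  "open_xyseries S \<longleftrightarrow>
     (\<forall>F\<in>S. \<exists>N. {G. \<forall>k. mdeg k < N \<longrightarrow> xycoeff G k = xycoeff F k} \<subseteq> S)"

instance
proof
  show "open (UNIV :: 'a xyseries set)" by (simp add: open_xyseries_def)
  show "open (S \<inter> T)" if S: "open S" and T: "open T" for S T :: "'a xyseries set"
    unfolding open_xyseries_def
  proof
    fix F assume F: "F \<in> S \<inter> T"
    obtain M where M: "{G. \<forall>k. mdeg k < M \<longrightarrow> xycoeff G k = xycoeff F k} \<subseteq> S"
      using F S unfolding open_xyseries_def by blast
    obtain N where N: "{G. \<forall>k. mdeg k < N \<longrightarrow> xycoeff G k = xycoeff F k} \<subseteq> T"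
      using F T unfolding open_xyseries_def by blast
    have "{G. \<forall>k. mdeg k < max M N \<longrightarrow> xycoeff G k = xycoeff F k} \<subseteq> S \<inter> T"
      using M N by (auto simp: less_max_iff_disj)
    then show "\<exists>N. {G. \<forall>k. mdeg k < N \<longrightarrow> xycoeff G k = xycoeff F k} \<subseteq> S \<inter> T" by blast
  qed
  show "open (\<Union>K)" if "\<forall>S\<in>K. open S" for K :: "'a xyseries set set"
    using that unfolding open_xyseries_def by (meson Sup_upper UnionE order_trans)
  show "\<exists>U V. open U \<and> open V \<and> F \<in> U \<and> G \<in> V \<and> U \<inter> V = {}" if "F \<noteq> G" for F G :: "'a xyseries"
  proof -
    obtain k where k: "xycoeff F k \<noteq> xycoeff G k" using \<open>F \<noteq> G\<close> xyseries_eqI by blast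
    have op: "open {H. xycoeff H k = c}" for c
      unfolding open_xyseries_def by (cases k) (auto intro!: exI[of _ "Suc (mdeg k)"])
    show ?thesis
      using k
      by (intro exI[of _ "{H. xycoeff H k = xycoeff F k}"] exI[of _ "{H. xycoeff H k = xycoeff G k}"]
            conjI op) auto
  qed
qed

end

lift_definition xvar :: "'v::finite \<Rightarrow> 'v xyseries"
  is "\<lambda>i k. if k = (axis i 1, 0) then 1 else 0" .

lift_definition yvar :: "'v::finite \<Rightarrow> 'v xyseries"
  is "\<lambda>i k. if k = (0, axis i 1) then 1 else 0" .

lift_definition dx :: "'v::finite \<Rightarrow> 'v xyseries \<Rightarrow> 'v xyseries"
  is "\<lambda>i F (n, m). of_nat (Suc (n $ i)) * F (n + axis i 1, m)" .

lift_definition dy :: "'v::finite \<Rightarrow> 'v xyseries \<Rightarrow> 'v xyseries"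
  is "\<lambda>i F (n, m). of_nat (Suc (m $ i)) * F (n, m + axis i 1)" .


section \<open>Operators and formal Hamiltonians\<close>

type_synonym 'v xyop = "'v xyseries \<Rightarrow> 'v xyseries"

definition opexp :: "'v::finite xyop \<Rightarrow> 'v xyop" where
  "opexp D = (\<lambda>F. \<Sum>k. (1 / fact k) *\<^sub>c (D ^^ k) F)"

definition ham_vf :: "'v::finite xyseries \<Rightarrow> 'v xyop" where
  "ham_vf G = (\<lambda>F. \<Sum>i\<in>UNIV. dx i G * dy i F - dy i G * dx i F)"

definition X_lin :: "complex^'v::finite \<Rightarrow> 'v xyop" where
  "X_lin lam = (\<lambda>F. - (\<Sum>i\<in>UNIV. lam $ i *\<^sub>c (xvar i * dx i F))
                    + (\<Sum>i\<in>UNIV. lam $ i *\<^sub>c (yvar i * dy i F)))"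

definition quad_ham :: "complex^'v::finite \<Rightarrow> 'v xyseries" where
  "quad_ham lam = (\<Sum>i\<in>UNIV. lam $ i *\<^sub>c (xvar i * yvar i))"

definition hamiltonian :: "complex^'v::finite \<Rightarrow> 'v expo set \<Rightarrow> ('v expo \<Rightarrow> complex) \<Rightarrow> 'v xyseries" where
  "hamiltonian lam A a = quad_ham lam + Abs_xyseries (\<lambda>k. if k \<in> A then a k else 0)"

definition weight :: "complex^'v::finite \<Rightarrow> 'v expo \<Rightarrow> complex" where
  "weight lam k = (\<Sum>j\<in>UNIV. lam $ j * (of_nat (snd k $ j) - of_nat (fst k $ j)))"

definition alphabet :: "complex^'v::finite \<Rightarrow> 'v expo set \<Rightarrow> complex set" where
  "alphabet lam A = weight lam ` A"

definition component :: "complex^'v::finite \<Rightarrow> 'v xyseries \<Rightarrow> complex \<Rightarrow> 'v xyseries" where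
  "component lam G w = Abs_xyseries (\<lambda>k. if mdeg k \<ge> 3 \<and> weight lam k = w then xycoeff G k else 0)"

definition formal_hamiltonian :: "complex^'v::finite \<Rightarrow> complex set \<Rightarrow> 'v xyseries \<Rightarrow> bool" where
  "formal_hamiltonian lam \<Omega> G \<longleftrightarrow>
     (\<forall>k. mdeg k < 3 \<longrightarrow> xycoeff G k = xycoeff (quad_ham lam) k) \<and>
     (\<forall>w. component lam G w \<noteq> 0 \<longrightarrow> w \<in> \<Omega>)"


section \<open>Simplification and the trimmed form\<close>

definition simp_gen :: "complex^'v::finite \<Rightarrow> complex set \<Rightarrow> 'v xyseries \<Rightarrow> 'v xyop" where
  "simp_gen lam \<Omega> G = (\<lambda>F. \<Sum>\<^sub>\<infinity>w\<in>\<Omega> - {0}. (1 / w) *\<^sub>c ham_vf (component lam G w) F)"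

text \<open>
  Simplification acts on vector fields. The Hamiltonian \<open>G\<close> with \<open>X = X\<^sub>G\<close> is unique, because \<open>X\<close>
  determines it up to a constant and formal Hamiltonians have no constant term.
\<close>

definition simp_vf :: "complex^'v::finite \<Rightarrow> complex set \<Rightarrow> 'v xyop \<Rightarrow> 'v xyop" where
  "simp_vf lam \<Omega> X =
     (let G = (THE G. formal_hamiltonian lam \<Omega> G \<and> ham_vf G = X); V = simp_gen lam \<Omega> G
      in opexp V \<circ> X \<circ> opexp (\<lambda>F. - V F))"

definition simp_iter :: "complex^'v::finite \<Rightarrow> complex set \<Rightarrow> 'v xyop \<Rightarrow> nat \<Rightarrow> 'v xyop" where
  "simp_iter lam \<Omega> X k = (simp_vf lam \<Omega> ^^ k) X"

definition X_tram :: "complex^'v::finite \<Rightarrow> complex set \<Rightarrow> 'v xyop \<Rightarrow> 'v xyop" where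
  "X_tram lam \<Omega> X = (\<lambda>F. lim (\<lambda>k. simp_iter lam \<Omega> X k F))"


section \<open>Words and moulds\<close>

text \<open>
  None of the moulds below depends on the alphabet, so they are defined on all words over \<open>\<complex>\<close>;
  on words over an additively closed \<open>\<Omega>\<close> the operations only involve values at words over \<open>\<Omega>\<close>.
\<close>

type_synonym mould = "complex list \<Rightarrow> complex"

definition word_op :: "complex^'v::finite \<Rightarrow> 'v xyseries \<Rightarrow> complex list \<Rightarrow> 'v xyop" where
  "word_op lam H ws = foldr (\<lambda>w P. ham_vf (component lam H w) \<circ> P) ws id"

definition mould_one :: mould where
  "mould_one ws = (if ws = [] then 1 else 0)"

definition mould_mult :: "mould \<Rightarrow> mould \<Rightarrow> mould" (infixl "\<times>\<^sub>m" 70) where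
  "(M \<times>\<^sub>m N) ws = (\<Sum>(u, v) | u @ v = ws. M u * N v)"

primrec mould_power :: "mould \<Rightarrow> nat \<Rightarrow> mould" where
  "mould_power M 0 = mould_one"
| "mould_power M (Suc k) = M \<times>\<^sub>m mould_power M k"

definition mould_exp :: "mould \<Rightarrow> mould" where
  "mould_exp M ws = (\<Sum>k. mould_power M k ws / fact k)"

definition mould_nabla :: "mould \<Rightarrow> mould" where
  "mould_nabla M ws = sum_list ws * M ws"

definition mould_comp :: "mould \<Rightarrow> mould \<Rightarrow> mould" (infixr "\<circ>\<^sub>m" 70) where
  "(M \<circ>\<^sub>m N) ws =
     (if ws = [] then M []
      else \<Sum>k = 1..length ws. \<Sum>us | length us = k \<and> concat us = ws \<and> [] \<notin> set us.
             M (map sum_list us) * prod_list (map N us))"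

definition mould_I :: mould where
  "mould_I ws = (if length ws = 1 then 1 else 0)"

text \<open>\<open>I\<close> is the right unit for composition, so the power with exponent 1 is the mould itself.\<close>

primrec mould_compow :: "mould \<Rightarrow> nat \<Rightarrow> mould" where
  "mould_compow M 0 = mould_I"
| "mould_compow M (Suc r) = M \<circ>\<^sub>m mould_compow M r"

definition mould_V :: mould where
  "mould_V ws = (case ws of [w] \<Rightarrow> if w \<noteq> 0 then 1 / w else 0 | _ \<Rightarrow> 0)"

definition Sam :: mould where
  "Sam = (\<lambda>ws. (mould_exp mould_V \<times>\<^sub>m mould_I \<times>\<^sub>m mould_exp (\<lambda>us. - mould_V us)) ws
             - (mould_nabla (mould_exp mould_V) \<times>\<^sub>m mould_exp (\<lambda>us. - mould_V us)) ws)"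

definition Tram :: mould where
  "Tram ws = (if ws = [] then 0 else mould_compow Sam (length ws) ws)"

end

theory Submission
  imports Defs
begin

text \<open>
  Put \<open>S = \<Sum> G\<^sub>\<omega> / \<omega>\<close>, summed over \<open>\<omega> \<noteq> 0\<close>. Then \<open>exp X\<^sub>S\<close> is an automorphism of the Poisson bracket, so one
  simplification step replaces \<open>G\<close> by \<open>exp X\<^sub>S G\<close>. On the other hand, contracting moulds with the operators
  \<open>X\<^sub>G\<^sub>\<omega>\<close> turns products of moulds into compositions and \<open>\<nabla>\<close> into the commutator with \<open>X\<^sub>l\<^sub>i\<^sub>n\<close>; hence the step is
  \<open>X\<^sub>G \<mapsto> X\<^sub>l\<^sub>i\<^sub>n + \<Sum> Sam\<^sup>w D\<^sub>w\<close>, and by homogeneity the component of weight \<open>\<omega>\<close> of the new Hamiltonian is the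
  part of this sum over the words with sum \<open>\<omega>\<close>. Substituting these components into one another is the
  composition of moulds, so the \<open>k\<close>-th iterate has the mould \<open>Sam\<^sup>k\<close>. Since \<open>Sam\<close> vanishes on nonzero letters and
  equals \<open>I\<close> on words of zeros, \<open>Sam\<^sup>k\<close> is stationary from \<open>k = r\<close> on at words of length \<open>r\<close>; long words
  only contribute in high degree, which gives the limit.
\<close>

text \<open>The factor 1/\<omega> is chosen so that \<open>Sam\<close> takes the value 1 -
  \<omega>/\<omega> = 0 on a nonzero letter: the step removes the letters of nonzero weight, and
  words of length at least two come in exchange. The operators of different words may satisfy
  relations, so a mould cannot be read off from its contraction. What can be read off is the part of
  each weight: the new Hamiltonian and the mould expansion give two decompositions of one operator
  into weight-homogeneous parts, and such a decomposition is unique. This identifies the new letters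
  and makes the step iterable. Two orders of composition meet. A simplification step puts
  \<open>Sam\<close> on the outside of the mould reached so far, while stability is seen by
  splitting off an innermost \<open>Sam\<close>; associativity of mould composition reconciles them.
  All infinite sums rest on one finiteness fact: a word raises degrees by at least its length, and
  only finitely many letters are visible below a given degree.\<close>

section \<open>Series and their order of vanishing\<close>

text \<open>Exponents are pairs; the default rules would split every quantified exponent.\<close>

declare split_paired_All [simp del] split_paired_Ex [simp del]

lemma mdeg_zero [simp]: "mdeg 0 = 0"
  by (simp add: mdeg_def)

lemma mdeg_add: "mdeg (p + q) = mdeg p + mdeg q"
  by (simp add: mdeg_def sum.distrib)

lemma finite_mdeg_less: "finite {k :: 'v::finite expo. mdeg k < N}"
proof (rule finite_subset)
  let ?B = "{n :: nat^'v. \<forall>i. n $ i \<le> (\<chi> i. N) $ i}"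
  show "finite (?B \<times> ?B)" by (intro finite_cartesian_product finite_vec_le)
  show "{k. mdeg k < N} \<subseteq> ?B \<times> ?B"
  proof
    fix k :: "'v expo" assume "k \<in> {k. mdeg k < N}"
    then have k: "mdeg k < N" by simp
    have "fst k $ i \<le> (\<Sum>i\<in>UNIV. fst k $ i)" "snd k $ i \<le> (\<Sum>i\<in>UNIV. snd k $ i)" for i
      by (simp_all add: member_le_sum)
    then have "fst k $ i \<le> N" "snd k $ i \<le> N" for i
      using k unfolding mdeg_def by (meson add_leD1 add_leD2 dual_order.trans less_imp_le)+
    then show "k \<in> ?B \<times> ?B" by (cases k) simp
  qed
qed

lemma xycoeff_zero [simp]: "xycoeff 0 k = 0" by transfer simp
lemma xycoeff_one: "xycoeff 1 k = (if k = 0 then 1 else 0)" by transfer simp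
lemma xycoeff_add [simp]: "xycoeff (F + G) k = xycoeff F k + xycoeff G k" by transfer simp
lemma xycoeff_diff [simp]: "xycoeff (F - G) k = xycoeff F k - xycoeff G k" by transfer simp
lemma xycoeff_minus [simp]: "xycoeff (- F) k = - xycoeff F k" by transfer simp
lemma xycoeff_scale [simp]: "xycoeff (c *\<^sub>c F) k = c * xycoeff F k" by transfer simp
lemma xycoeff_mult: "xycoeff (F * G) k = (\<Sum>(p, q) | p + q = k. xycoeff F p * xycoeff G q)"
  by transfer simp
lemma xycoeff_Abs [simp]: "xycoeff (Abs_xyseries f) = f"
  by (simp add: Abs_xyseries_inverse)
lemma xycoeff_sum: "xycoeff (sum f T) k = (\<Sum>i\<in>T. xycoeff (f i) k)"
  by (induction T rule: infinite_finite_induct) auto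

lemma xyscale_simps:
  "c *\<^sub>c (F + G) = c *\<^sub>c F + c *\<^sub>c G" "(c + d) *\<^sub>c F = c *\<^sub>c F + d *\<^sub>c F"
  "c *\<^sub>c (F - G) = c *\<^sub>c F - c *\<^sub>c G" "(c - d) *\<^sub>c F = c *\<^sub>c F - d *\<^sub>c F"
  "c *\<^sub>c d *\<^sub>c F = (c * d) *\<^sub>c F" "1 *\<^sub>c F = F" "0 *\<^sub>c F = 0" "c *\<^sub>c 0 = 0"
  "(- c) *\<^sub>c F = - (c *\<^sub>c F)" "c *\<^sub>c (- F) = - (c *\<^sub>c F)"
  by (rule xyseries_eqI; simp add: algebra_simps)+

lemma xyscale_sum_left: "(\<Sum>i\<in>T. c i) *\<^sub>c F = (\<Sum>i\<in>T. c i *\<^sub>c F)"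
  by (rule xyseries_eqI) (simp add: xycoeff_sum sum_distrib_right)

lemma xyscale_sum_right: "c *\<^sub>c (\<Sum>i\<in>T. f i) = (\<Sum>i\<in>T. c *\<^sub>c f i)"
  by (rule xyseries_eqI) (simp add: xycoeff_sum sum_distrib_left)

lemma xyscale_mult: "(c *\<^sub>c F) * G = c *\<^sub>c (F * G)" "F * (c *\<^sub>c G) = c *\<^sub>c (F * G)"
  by (rule xyseries_eqI, simp add: xycoeff_mult sum_distrib_left case_prod_unfold mult.assoc mult.left_commute)+

text \<open>This is membership in the N-th power of the maximal ideal. These ideals are the basic
  neighbourhoods of 0, so continuity and convergence can be expressed through N alone.\<close>

definition vanish :: "nat \<Rightarrow> 'v::finite xyseries \<Rightarrow> bool" where
  "vanish N F \<longleftrightarrow> (\<forall>k. mdeg k < N \<longrightarrow> xycoeff F k = 0)"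

lemma vanishD: "vanish N F \<Longrightarrow> mdeg k < N \<Longrightarrow> xycoeff F k = 0"
  by (simp add: vanish_def)

lemma vanish_mono: "vanish N F \<Longrightarrow> M \<le> N \<Longrightarrow> vanish M F"
  by (simp add: vanish_def)

lemma vanish_0 [simp]: "vanish 0 F" "vanish N 0"
  by (simp_all add: vanish_def)

lemma vanish_diff: "vanish N F \<Longrightarrow> vanish N G \<Longrightarrow> vanish N (F - G)"
  by (simp add: vanish_def)

lemma vanish_scale: "vanish N F \<Longrightarrow> vanish N (c *\<^sub>c F)"
  by (simp add: vanish_def)

lemma vanish_sum: "(\<And>i. i \<in> T \<Longrightarrow> vanish N (f i)) \<Longrightarrow> vanish N (sum f T)"
  by (simp add: vanish_def xycoeff_sum)

lemma vanish_mult: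
  assumes "vanish M F" "vanish N G"
  shows "vanish (M + N) (F * G)"
  unfolding vanish_def xycoeff_mult
proof (intro allI impI sum.neutral ballI)
  fix k u assume k: "mdeg (k :: 'a expo) < M + N" and u: "u \<in> {(p, q). p + q = k}"
  then obtain p q where pq: "u = (p, q)" "p + q = k" by auto
  then have "mdeg p < M \<or> mdeg q < N" using k mdeg_add[of p q] by auto
  then show "(case u of (p, q) \<Rightarrow> xycoeff F p * xycoeff G q) = 0"
    using assms by (auto simp: pq vanish_def)
qed

section \<open>Sums in the adic topology\<close>

text \<open>There are only finitely many exponents below each degree, so eventual agreement at every
  single exponent is already eventual agreement up to that degree.\<close>

lemma xyseries_tendsto_iff:
  "(f \<longlongrightarrow> L) \<F> \<longleftrightarrow> (\<forall>k. eventually (\<lambda>x. xycoeff (f x) k = xycoeff L k) \<F>)"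
proof
  assume f: "(f \<longlongrightarrow> L) \<F>"
  have "open {G. xycoeff G k = xycoeff L k}" for k
    unfolding open_xyseries_def by (cases k) (auto intro!: exI[of _ "Suc (mdeg k)"])
  then show "\<forall>k. eventually (\<lambda>x. xycoeff (f x) k = xycoeff L k) \<F>"
    using topological_tendstoD[OF f, of "{G. xycoeff G k = xycoeff L k}" for k] by auto
next
  assume f: "\<forall>k. eventually (\<lambda>x. xycoeff (f x) k = xycoeff L k) \<F>"
  show "(f \<longlongrightarrow> L) \<F>"
  proof (rule topological_tendstoI)
    fix S assume "open S" "L \<in> S"
    then obtain N where N: "{G. \<forall>k. mdeg k < N \<longrightarrow> xycoeff G k = xycoeff L k} \<subseteq> S"
      unfolding open_xyseries_def by blast
    have "eventually (\<lambda>x. \<forall>k\<in>{k. mdeg k < N}. xycoeff (f x) k = xycoeff L k) \<F>"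
      by (rule eventually_ball_finite) (use f finite_mdeg_less in auto)
    then show "eventually (\<lambda>x. f x \<in> S) \<F>"
      by eventually_elim (use N in auto)
  qed
qed

text \<open>This is the working criterion for summability: each coefficient of the sum is a finite
  sum of complex numbers, so rearrangement and regrouping are unrestricted.\<close>

definition locally_finite :: "('i \<Rightarrow> 'v::finite xyseries) \<Rightarrow> 'i set \<Rightarrow> bool" where
  "locally_finite f A \<longleftrightarrow> (\<forall>k. finite {i \<in> A. xycoeff (f i) k \<noteq> 0})"

lemma locally_finite_has_sum:
  assumes "locally_finite f A"
  shows "(f has_sum Abs_xyseries (\<lambda>k. \<Sum>i | i \<in> A \<and> xycoeff (f i) k \<noteq> 0. xycoeff (f i) k)) A"
  unfolding has_sum_def xyseries_tendsto_iff
proof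
  fix k
  let ?T = "{i \<in> A. xycoeff (f i) k \<noteq> 0}"
  have fin: "finite ?T" using assms by (simp add: locally_finite_def)
  have "eventually (\<lambda>T. finite T \<and> ?T \<subseteq> T \<and> T \<subseteq> A) (finite_subsets_at_top A)"
    unfolding eventually_finite_subsets_at_top using fin by (intro exI[of _ ?T]) auto
  then show "\<forall>\<^sub>F T in finite_subsets_at_top A. xycoeff (sum f T) k =
      xycoeff (Abs_xyseries (\<lambda>k. \<Sum>i | i \<in> A \<and> xycoeff (f i) k \<noteq> 0. xycoeff (f i) k)) k"
  proof eventually_elim
    case (elim T)
    then show ?case
      by (simp add: xycoeff_sum) (rule sum.mono_neutral_right, auto)
  qed
qed

lemma locally_finite_summable: "locally_finite f A \<Longrightarrow> f summable_on A"
  using locally_finite_has_sum summable_on_def by blast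

lemma xycoeff_infsum_sum:
  assumes "locally_finite f A" "finite T" "T \<subseteq> A" "\<And>i. i \<in> A \<Longrightarrow> i \<notin> T \<Longrightarrow> xycoeff (f i) k = 0"
  shows "xycoeff (infsum f A) k = (\<Sum>i\<in>T. xycoeff (f i) k)"
proof -
  have "xycoeff (infsum f A) k = (\<Sum>i | i \<in> A \<and> xycoeff (f i) k \<noteq> 0. xycoeff (f i) k)"
    by (simp add: infsumI[OF locally_finite_has_sum[OF assms(1)]])
  also have "\<dots> = (\<Sum>i\<in>T. xycoeff (f i) k)"
    using assms by (intro sum.mono_neutral_left) auto
  finally show ?thesis .
qed

lemma summable_finite_support:
  fixes f :: "'i \<Rightarrow> complex"
  assumes "finite {i \<in> A. f i \<noteq> 0}"
  shows "f summable_on A" "infsum f A = sum f {i \<in> A. f i \<noteq> 0}"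
proof -
  have "f summable_on A \<longleftrightarrow> f summable_on {i \<in> A. f i \<noteq> 0}"
    by (rule summable_on_cong_neutral) auto
  then show "f summable_on A" by (simp add: assms)
  have "infsum f A = infsum f {i \<in> A. f i \<noteq> 0}" by (rule infsum_cong_neutral) auto
  then show "infsum f A = sum f {i \<in> A. f i \<noteq> 0}" by (simp add: assms)
qed

lemma xycoeff_infsum: "locally_finite f A \<Longrightarrow> xycoeff (infsum f A) k = infsum (\<lambda>i. xycoeff (f i) k) A"
  by (subst xycoeff_infsum_sum[where T = "{i \<in> A. xycoeff (f i) k \<noteq> 0}"])
     (auto simp: locally_finite_def summable_finite_support)

lemma locally_finite_coeff_summable: "locally_finite f A \<Longrightarrow> (\<lambda>i. xycoeff (f i) k) summable_on A"
  by (simp add: locally_finite_def summable_finite_support)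

lemma locally_finite_add: "locally_finite f A \<Longrightarrow> locally_finite g A \<Longrightarrow> locally_finite (\<lambda>i. f i + g i) A"
  unfolding locally_finite_def
proof
  fix k assume "\<forall>k. finite {i \<in> A. xycoeff (f i) k \<noteq> 0}" "\<forall>k. finite {i \<in> A. xycoeff (g i) k \<noteq> 0}"
  then have "finite ({i \<in> A. xycoeff (f i) k \<noteq> 0} \<union> {i \<in> A. xycoeff (g i) k \<noteq> 0})" by blast
  then show "finite {i \<in> A. xycoeff (f i + g i) k \<noteq> 0}" by (rule rev_finite_subset) auto
qed

lemma locally_finite_scale: "locally_finite f A \<Longrightarrow> locally_finite (\<lambda>i. c i *\<^sub>c f i) A"
  unfolding locally_finite_def by (auto intro: finite_subset[of _ "{i \<in> A. xycoeff (f i) k \<noteq> 0}" for k])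

lemma infsum_locally_finite_add:
  assumes "locally_finite f A" "locally_finite g A"
  shows "infsum (\<lambda>i. f i + g i) A = infsum f A + infsum g A"
  by (rule xyseries_eqI)
     (simp add: xycoeff_infsum locally_finite_add assms infsum_add locally_finite_coeff_summable)

lemma infsum_locally_finite_scale:
  assumes "locally_finite f A"
  shows "infsum (\<lambda>i. c *\<^sub>c f i) A = c *\<^sub>c infsum f A"
  by (rule xyseries_eqI)
     (simp add: xycoeff_infsum locally_finite_scale assms infsum_cmult_right locally_finite_coeff_summable)

lemma infsum_locally_finite_diff:
  assumes "locally_finite f A" "locally_finite g A"
  shows "infsum (\<lambda>i. f i - g i) A = infsum f A - infsum g A"
proof -
  have "infsum (\<lambda>i. f i + (- 1) *\<^sub>c g i) A = infsum f A + (- 1) *\<^sub>c infsum g A"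
    by (simp only: infsum_locally_finite_add[OF assms(1) locally_finite_scale[OF assms(2)]] infsum_locally_finite_scale[OF assms(2)])
  then show ?thesis by (simp add: xyscale_simps)
qed

text \<open>Fubini, checked coefficient by coefficient. Inner sums may cancel, so the support of the
  outer family is only contained in the projection of the finite support of the double
  family.\<close>

lemma infsum_locally_finite_Sigma:
  assumes "locally_finite (\<lambda>(i, j). f i j) (Sigma A B)"
  shows "i \<in> A \<Longrightarrow> locally_finite (f i) (B i)"
    and "locally_finite (\<lambda>i. infsum (f i) (B i)) A"
    and "infsum (\<lambda>i. infsum (f i) (B i)) A = infsum (\<lambda>(i, j). f i j) (Sigma A B)"
proof -
  have fin: "finite {u \<in> Sigma A B. xycoeff (f (fst u) (snd u)) k \<noteq> 0}" for k
    using assms by (simp add: locally_finite_def case_prod_unfold)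
  show lf: "locally_finite (f i) (B i)" if "i \<in> A" for i
    unfolding locally_finite_def
  proof
    fix k
    show "finite {j \<in> B i. xycoeff (f i j) k \<noteq> 0}"
      by (rule finite_subset[OF _ finite_imageI[OF fin[of k], of snd]]) (use that in \<open>force simp: image_iff\<close>)
  qed
  show lf': "locally_finite (\<lambda>i. infsum (f i) (B i)) A"
    unfolding locally_finite_def
  proof
    fix k
    show "finite {i \<in> A. xycoeff (infsum (f i) (B i)) k \<noteq> 0}"
    proof (rule finite_subset[OF _ finite_imageI[OF fin[of k], of fst]], rule subsetI, rule ccontr)
      fix i assume i: "i \<in> {i \<in> A. xycoeff (infsum (f i) (B i)) k \<noteq> 0}"
        and ni: "i \<notin> fst ` {u \<in> Sigma A B. xycoeff (f (fst u) (snd u)) k \<noteq> 0}"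
      then have "\<forall>j\<in>B i. xycoeff (f i j) k = 0" by (force simp: image_iff)
      then have "xycoeff (infsum (f i) (B i)) k = 0"
        using i lf by (simp add: xycoeff_infsum infsum_0)
      then show False using i by simp
    qed
  qed
  show "infsum (\<lambda>i. infsum (f i) (B i)) A = infsum (\<lambda>(i, j). f i j) (Sigma A B)"
  proof (rule xyseries_eqI)
    fix k
    have "xycoeff (infsum (\<lambda>i. infsum (f i) (B i)) A) k = infsum (\<lambda>i. infsum (\<lambda>j. xycoeff (f i j) k) (B i)) A"
      by (simp add: xycoeff_infsum lf lf' cong: infsum_cong)
    also have "\<dots> = infsum (\<lambda>(i, j). xycoeff (f i j) k) (Sigma A B)"
      by (rule infsum_Sigma'_banach)
         (use locally_finite_coeff_summable[OF assms, of k] in \<open>simp add: case_prod_unfold\<close>)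
    also have "\<dots> = xycoeff (infsum (\<lambda>(i, j). f i j) (Sigma A B)) k"
      unfolding xycoeff_infsum[OF assms] by (simp add: case_prod_unfold)
    finally show "xycoeff (infsum (\<lambda>i. infsum (f i) (B i)) A) k =
        xycoeff (infsum (\<lambda>(i, j). f i j) (Sigma A B)) k" .
  qed
qed

lemma locally_finite_reindex: "inj_on h A \<Longrightarrow> locally_finite f (h ` A) = locally_finite (\<lambda>i. f (h i)) A"
proof -
  assume inj: "inj_on h A"
  have "{i \<in> h ` A. xycoeff (f i) k \<noteq> 0} = h ` {i \<in> A. xycoeff (f (h i)) k \<noteq> 0}" for k by auto
  moreover have "inj_on h {i \<in> A. xycoeff (f (h i)) k \<noteq> 0}" for k
    using inj by (rule inj_on_subset) auto
  ultimately show ?thesis by (simp add: locally_finite_def finite_image_iff)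
qed

text \<open>Regrouping along g is Fubini over the graph of g, read as a disjoint union of
  fibres.\<close>

lemma infsum_locally_finite_fibres:
  assumes "locally_finite f A" "g ` A \<subseteq> B"
  shows "locally_finite (\<lambda>j. infsum f {i \<in> A. g i = j}) B"
    and "infsum f A = infsum (\<lambda>j. infsum f {i \<in> A. g i = j}) B"
proof -
  have eq: "Sigma B (\<lambda>j. {i \<in> A. g i = j}) = (\<lambda>i. (g i, i)) ` A" using assms(2) by auto
  have inj: "inj_on (\<lambda>i. (g i, i)) A" by (auto simp: inj_on_def)
  have lf: "locally_finite (\<lambda>(j, i). f i) (Sigma B (\<lambda>j. {i \<in> A. g i = j}))"
    unfolding eq locally_finite_reindex[OF inj] using assms by simp
  show "locally_finite (\<lambda>j. infsum f {i \<in> A. g i = j}) B"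
    using infsum_locally_finite_Sigma(2)[OF lf] .
  show "infsum f A = infsum (\<lambda>j. infsum f {i \<in> A. g i = j}) B"
    using infsum_locally_finite_Sigma(3)[OF lf] unfolding eq infsum_reindex[OF inj] by (simp add: o_def)
qed

lemma suminf_locally_finite: "locally_finite f (UNIV :: nat set) \<Longrightarrow> suminf f = infsum f UNIV"
  using has_sum_imp_sums[of f "infsum f UNIV"] locally_finite_summable[of f UNIV] by (simp add: sums_iff)

section \<open>Continuous linear operators\<close>

text \<open>For a linear map the last clause, continuity at 0, is continuity everywhere; it is what
  lets the map pass through locally finite sums.\<close>

definition cont_linear :: "'v::finite xyop \<Rightarrow> bool" where
  "cont_linear L \<longleftrightarrow> (\<forall>F G. L (F + G) = L F + L G) \<and> (\<forall>c F. L (c *\<^sub>c F) = c *\<^sub>c L F) \<and>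
     (\<forall>N. \<exists>M. \<forall>F. vanish M F \<longrightarrow> vanish N (L F))"

lemma cont_linear_add: "cont_linear L \<Longrightarrow> L (F + G) = L F + L G"
  and cont_linear_scale: "cont_linear L \<Longrightarrow> L (c *\<^sub>c F) = c *\<^sub>c L F"
  by (auto simp: cont_linear_def)

lemma cont_linear_zero: "cont_linear L \<Longrightarrow> L 0 = 0"
  using cont_linear_scale[of L 0 0] by (simp add: xyscale_simps)

lemma cont_linear_minus: "cont_linear L \<Longrightarrow> L (- F) = - L F"
  using cont_linear_scale[of L "- 1" F] by (simp add: xyscale_simps)

lemma cont_linear_diff: "cont_linear L \<Longrightarrow> L (F - G) = L F - L G"
  using cont_linear_add[of L F "- G"] by (simp add: cont_linear_minus)

lemma cont_linear_sum: "cont_linear L \<Longrightarrow> L (sum f T) = (\<Sum>i\<in>T. L (f i))"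
  by (induction T rule: infinite_finite_induct) (auto simp: cont_linear_zero cont_linear_add)

lemma cont_linear_infsum:
  assumes "cont_linear L" "locally_finite f A"
  shows "locally_finite (\<lambda>i. L (f i)) A" and "L (infsum f A) = infsum (\<lambda>i. L (f i)) A"
proof -
  have *: "\<exists>T. finite T \<and> T \<subseteq> A \<and> (\<forall>i\<in>A - T. xycoeff (L (f i)) k = 0) \<and>
     xycoeff (L (infsum f A)) k = (\<Sum>i\<in>T. xycoeff (L (f i)) k)" for k
  proof -
    obtain M where M: "\<And>F. vanish M F \<Longrightarrow> vanish (Suc (mdeg k)) (L F)"
      using assms(1) unfolding cont_linear_def by blast
    \<comment> \<open>Coefficient k of an image under L depends only on degrees below M. T collects
      the terms that have a nonzero coefficient there, a finite union of finite sets.\<close>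
    define T where "T = (\<Union>j\<in>{j. mdeg j < M}. {i \<in> A. xycoeff (f i) j \<noteq> 0})"
    have T: "finite T" "T \<subseteq> A"
      using assms(2) finite_mdeg_less unfolding T_def locally_finite_def by blast+
    have nT: "vanish M (f i)" if "i \<in> A - T" for i
      using that by (auto simp: T_def vanish_def)
    have "vanish M (infsum f A - sum f T)"
      unfolding vanish_def
    proof (intro allI impI)
      fix j :: "'a expo" assume "mdeg j < M"
      then have "xycoeff (infsum f A) j = (\<Sum>i\<in>T. xycoeff (f i) j)"
        using nT by (intro xycoeff_infsum_sum[OF assms(2) T]) (auto simp: vanish_def)
      then show "xycoeff (infsum f A - sum f T) j = 0" by (simp add: xycoeff_sum)
    qed
    then have "xycoeff (L (infsum f A - sum f T)) k = 0" using M vanishD by blast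
    then have "xycoeff (L (infsum f A)) k = (\<Sum>i\<in>T. xycoeff (L (f i)) k)"
      by (simp add: cont_linear_diff cont_linear_sum assms(1) xycoeff_sum)
    moreover have "xycoeff (L (f i)) k = 0" if "i \<in> A - T" for i
      using M[OF nT[OF that]] vanishD by blast
    ultimately show ?thesis using T by blast
  qed
  show lf: "locally_finite (\<lambda>i. L (f i)) A"
    unfolding locally_finite_def
  proof
    fix k
    obtain T where "finite T" "\<forall>i\<in>A - T. xycoeff (L (f i)) k = 0" using *[of k] by blast
    then show "finite {i \<in> A. xycoeff (L (f i)) k \<noteq> 0}" by (auto intro: finite_subset)
  qed
  show "L (infsum f A) = infsum (\<lambda>i. L (f i)) A"
  proof (rule xyseries_eqI)
    fix k
    obtain T where "finite T" "T \<subseteq> A" "\<forall>i\<in>A - T. xycoeff (L (f i)) k = 0"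
      "xycoeff (L (infsum f A)) k = (\<Sum>i\<in>T. xycoeff (L (f i)) k)" using *[of k] by blast
    then show "xycoeff (L (infsum f A)) k = xycoeff (infsum (\<lambda>i. L (f i)) A) k"
      by (subst xycoeff_infsum_sum[OF lf, of T]) auto
  qed
qed

lemma cont_linear_id: "cont_linear id" and cont_linear_comp: "cont_linear L \<Longrightarrow> cont_linear L' \<Longrightarrow> cont_linear (L \<circ> L')"
  unfolding cont_linear_def by (auto, meson)

definition raises :: "nat \<Rightarrow> 'v::finite xyop \<Rightarrow> bool" where
  "raises p L \<longleftrightarrow> (\<forall>N F. vanish N F \<longrightarrow> vanish (N + p) (L F))"

lemma raisesD: "raises p L \<Longrightarrow> vanish N F \<Longrightarrow> vanish (N + p) (L F)"
  by (auto simp: raises_def)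

lemma raises_mono: "raises p L \<Longrightarrow> q \<le> p \<Longrightarrow> raises q L"
  unfolding raises_def by (meson add_left_mono vanish_mono)

lemma raises_comp: "raises p L \<Longrightarrow> raises q L' \<Longrightarrow> raises (p + q) (L \<circ> L')"
  unfolding raises_def by (metis add.assoc add.commute comp_apply)

section \<open>Partial derivatives and Hamiltonian vector fields\<close>

definition unit_x :: "'v::finite \<Rightarrow> 'v expo" where "unit_x i = (axis i 1, 0)"
definition unit_y :: "'v::finite \<Rightarrow> 'v expo" where "unit_y i = (0, axis i 1)"

lemma unit_x_nth [simp]: "fst (unit_x i) $ j = (if j = i then 1 else 0)" "snd (unit_x i) = 0"
  and unit_y_nth [simp]: "snd (unit_y i) $ j = (if j = i then 1 else 0)" "fst (unit_y i) = 0"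
  by (auto simp: unit_x_def unit_y_def axis_def)

lemma mdeg_unit_x [simp]: "mdeg (unit_x i) = 1" and mdeg_unit_y [simp]: "mdeg (unit_y i) = 1"
  by (simp_all add: mdeg_def)

lemma unit_x_split: "fst k $ i > 0 \<Longrightarrow> \<exists>q. k = q + unit_x i"
  by (rule exI[of _ "(\<chi> j. if j = i then fst k $ j - 1 else fst k $ j, snd k)"])
     (auto simp: prod_eq_iff vec_eq_iff)

lemma unit_y_split: "snd k $ i > 0 \<Longrightarrow> \<exists>q. k = q + unit_y i"
  by (rule exI[of _ "(fst k, \<chi> j. if j = i then snd k $ j - 1 else snd k $ j)"])
     (auto simp: prod_eq_iff vec_eq_iff)

lemma xycoeff_dx: "xycoeff (dx i F) k = of_nat (Suc (fst k $ i)) * xycoeff F (k + unit_x i)"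
  unfolding unit_x_def by transfer (simp add: case_prod_unfold plus_prod_def)

lemma xycoeff_dy: "xycoeff (dy i F) k = of_nat (Suc (snd k $ i)) * xycoeff F (k + unit_y i)"
  unfolding unit_y_def by transfer (simp add: case_prod_unfold plus_prod_def)

text \<open>An abstract index shift shared by \<open>dx\<close> and \<open>dy\<close>: e is the
  exponent of one variable and c reads off its power. Terms with c p = 0 are killed by the factor,
  all others have p = p' + e.\<close>

lemma pderiv_coeff_sum:
  fixes F G :: "'v::finite expo \<Rightarrow> complex" and c :: "'v expo \<Rightarrow> nat"
  assumes c: "\<And>p. c (p + e) = Suc (c p)" and e: "\<And>p. c p > 0 \<Longrightarrow> \<exists>q. p = q + e"
  shows "(\<Sum>(p, q) | p + q = k + e. of_nat (c p) * F p * G q) =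
         (\<Sum>(p, q) | p + q = k. of_nat (Suc (c p)) * F (p + e) * G q)"
proof -
  let ?h = "\<lambda>(p, q). (p + e, q)"
  have "(\<Sum>(p, q) | p + q = k. of_nat (Suc (c p)) * F (p + e) * G q) =
        (\<Sum>(p, q) \<in> ?h ` {(p, q). p + q = k}. of_nat (c p) * F p * G q)"
    by (subst sum.reindex) (auto simp: inj_on_def c case_prod_unfold prod_eq_iff)
  also have "\<dots> = (\<Sum>(p, q) | p + q = k + e. of_nat (c p) * F p * G q)"
  proof (rule sum.mono_neutral_left[OF finite_expo_split])
    show "?h ` {(p, q). p + q = k} \<subseteq> {(p, q). p + q = k + e}" by (auto simp: add_ac)
    show "\<forall>u\<in>{(p, q). p + q = k + e} - ?h ` {(p, q). p + q = k}.
            (case u of (p, q) \<Rightarrow> of_nat (c p) * F p * G q) = 0"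
    proof
      fix u assume u: "u \<in> {(p, q). p + q = k + e} - ?h ` {(p, q). p + q = k}"
      obtain p q where pq: "u = (p, q)" by (cases u)
      have "\<not> c p > 0"
      proof
        assume "c p > 0"
        then obtain p' where p': "p = p' + e" using e by blast
        then have "p' + q + e = k + e" using u pq by (simp add: add_ac)
        then have "p' + q = k" by simp
        then have "u \<in> ?h ` {(p, q). p + q = k}" using pq p' by (auto intro!: image_eqI[of _ _ "(p', q)"])
        then show False using u by blast
      qed
      then show "(case u of (p, q) \<Rightarrow> of_nat (c p) * F p * G q) = 0" by (simp add: pq)
    qed
  qed
  finally show ?thesis by simp
qed

text \<open>The Leibniz rule at one coefficient: for p + q = k + e the factor c k + 1 produced by
  the derivative splits as c p + c q, and each half is shifted back.\<close>

lemma pderiv_coeff_mult: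
  fixes F G :: "'v::finite expo \<Rightarrow> complex" and c :: "'v expo \<Rightarrow> nat"
  assumes c: "\<And>p. c (p + e) = Suc (c p)" and e: "\<And>p. c p > 0 \<Longrightarrow> \<exists>q. p = q + e"
    and add: "\<And>p q. c (p + q) = c p + c q"
  shows "of_nat (Suc (c k)) * (\<Sum>(p, q) | p + q = k + e. F p * G q) =
         (\<Sum>(p, q) | p + q = k. (of_nat (Suc (c p)) * F (p + e)) * G q) +
         (\<Sum>(p, q) | p + q = k. F p * (of_nat (Suc (c q)) * G (q + e)))"
proof -
  have swap: "(\<Sum>(p, q) | p + q = j. h p q) = (\<Sum>(p, q) | p + q = j. h q p)"
    for h :: "'v expo \<Rightarrow> 'v expo \<Rightarrow> complex" and j
    by (rule sum.reindex_bij_witness[where i = prod.swap and j = prod.swap]) (auto simp: add.commute)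
  have "of_nat (Suc (c k)) * (\<Sum>(p, q) | p + q = k + e. F p * G q) =
        (\<Sum>(p, q) | p + q = k + e. of_nat (c p) * F p * G q + of_nat (c q) * G q * F p)"
    unfolding sum_distrib_left
  proof (rule sum.cong[OF refl], clarify)
    fix a b a' b' assume h: "(a, b) + (a', b') = k + e"
    have "c k + 1 = c (a, b) + c (a', b')" using h c[of k] add by (metis Suc_eq_plus1)
    then have "of_nat (Suc (c k)) = (of_nat (c (a, b)) + of_nat (c (a', b')) :: complex)"
      by (metis Suc_eq_plus1 of_nat_add)
    then show "of_nat (Suc (c k)) * (F (a, b) * G (a', b')) =
      of_nat (c (a, b)) * F (a, b) * G (a', b') + of_nat (c (a', b')) * G (a', b') * F (a, b)"
      by (simp add: algebra_simps)
  qed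
  also have "\<dots> = (\<Sum>(p, q) | p + q = k + e. of_nat (c p) * F p * G q) +
      (\<Sum>(p, q) | p + q = k + e. of_nat (c q) * G q * F p)"
    by (simp add: sum.distrib case_prod_unfold)
  also have "(\<Sum>(p, q) | p + q = k + e. of_nat (c q) * G q * F p) =
      (\<Sum>(p, q) | p + q = k + e. of_nat (c p) * G p * F q)" by (rule swap)
  also have "\<dots> = (\<Sum>(p, q) | p + q = k. of_nat (Suc (c p)) * G (p + e) * F q)"
    by (rule pderiv_coeff_sum[where c = c and e = e, OF c e])
  also have "\<dots> = (\<Sum>(p, q) | p + q = k. of_nat (Suc (c q)) * G (q + e) * F p)" by (rule swap)
  also have "(\<Sum>(p, q) | p + q = k + e. of_nat (c p) * F p * G q) =
      (\<Sum>(p, q) | p + q = k. of_nat (Suc (c p)) * F (p + e) * G q)"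
    by (rule pderiv_coeff_sum[where c = c and e = e, OF c e])
  finally show ?thesis by (simp only: mult.commute mult.left_commute mult.assoc)
qed

lemma dx_mult: "dx i (F * G) = dx i F * G + F * dx i G"
  by (rule xyseries_eqI, simp only: xycoeff_add xycoeff_dx xycoeff_mult)
     (rule pderiv_coeff_mult, auto intro: unit_x_split)

lemma dy_mult: "dy i (F * G) = dy i F * G + F * dy i G"
  by (rule xyseries_eqI, simp only: xycoeff_add xycoeff_dy xycoeff_mult)
     (rule pderiv_coeff_mult, auto intro: unit_y_split)

lemma partial_add: "dx i (F + G) = dx i F + dx i G" "dy i (F + G) = dy i F + dy i G"
  and partial_diff: "dx i (F - G) = dx i F - dx i G" "dy i (F - G) = dy i F - dy i G"
  and partial_scale: "dx i (c *\<^sub>c F) = c *\<^sub>c dx i F" "dy i (c *\<^sub>c F) = c *\<^sub>c dy i F"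
  and partial_zero: "dx i 0 = 0" "dy i 0 = 0"
  by (rule xyseries_eqI; simp add: xycoeff_dx xycoeff_dy algebra_simps)+

lemma partial_sum: "dx i (sum f T) = (\<Sum>j\<in>T. dx i (f j))" "dy i (sum f T) = (\<Sum>j\<in>T. dy i (f j))"
  by (induction T rule: infinite_finite_induct) (auto simp: partial_add partial_zero)

lemma partial_commute:
  "dx i (dx j F) = dx j (dx i F)" "dy i (dy j F) = dy j (dy i F)" "dx i (dy j F) = dy j (dx i F)"
  by (rule xyseries_eqI; simp add: xycoeff_dx xycoeff_dy add_ac)+

lemma vanish_partial:
  assumes "vanish N F" shows "vanish (N - 1) (dx i F)" "vanish (N - 1) (dy i F)"
  using assms by (auto simp: vanish_def xycoeff_dx xycoeff_dy mdeg_add)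

section \<open>The Poisson bracket\<close>

lemma ham_vf_add: "ham_vf G (F + K) = ham_vf G F + ham_vf G K"
  and ham_vf_scale: "ham_vf G (c *\<^sub>c F) = c *\<^sub>c ham_vf G F"
  by (simp_all add: ham_vf_def partial_add partial_scale xyscale_mult xyscale_sum_right
        xyscale_simps algebra_simps sum.distrib sum_subtractf)

lemma ham_vf_antisym: "ham_vf G F = - ham_vf F G"
  by (simp add: ham_vf_def mult.commute flip: sum_negf)

lemma vanish_ham_vf_lower: "vanish (N + 2) F \<Longrightarrow> vanish N (ham_vf G F)"
  unfolding ham_vf_def
proof (intro vanish_sum vanish_diff)
  fix i assume F: "vanish (N + 2) F"
  show "vanish N (dx i G * dy i F)" "vanish N (dy i G * dx i F)"
    using vanish_mult[of 0 "dx i G" "N + 1" "dy i F"] vanish_mult[of 0 "dy i G" "N + 1" "dx i F"]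
      vanish_partial[OF F, of i] by (auto intro: vanish_mono)
qed

text \<open>Each of the two derivatives costs one degree. Thus a Hamiltonian starting in degree 3
  still gains one, which drives every convergence argument below.\<close>

lemma raises_ham_vf:
  assumes "vanish (p + 2) G"
  shows "raises p (ham_vf G)"
  unfolding raises_def
proof (intro allI impI)
  fix N and F :: "'a xyseries" assume F: "vanish N F"
  show "vanish (N + p) (ham_vf G F)"
    unfolding ham_vf_def
  proof (intro vanish_sum vanish_diff)
    fix i
    have "vanish (p + 1 + (N - 1)) (dx i G * dy i F)" "vanish (p + 1 + (N - 1)) (dy i G * dx i F)"
      using vanish_partial[OF assms, of i] vanish_partial[OF F, of i]
        vanish_mult[of "p + 1" "dx i G" "N - 1" "dy i F"] vanish_mult[of "p + 1" "dy i G" "N - 1" "dx i F"]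
      by simp_all
    \<comment> \<open>Subtraction is truncated here: the bound is N + p for positive N, and p + 1
      for N = 0.\<close>
    then show "vanish (N + p) (dx i G * dy i F)" "vanish (N + p) (dy i G * dx i F)"
      by (auto elim!: vanish_mono)
  qed
qed

lemma cont_linear_ham_vf: "cont_linear (ham_vf G)"
  unfolding cont_linear_def by (meson ham_vf_add ham_vf_scale vanish_ham_vf_lower)

lemma cont_linear_uminus: "cont_linear L \<Longrightarrow> cont_linear (\<lambda>F. - L F)"
  unfolding cont_linear_def by (simp add: xyscale_simps vanish_def)

lemma cont_linear_ham_vf_left: "cont_linear (\<lambda>G. ham_vf G F)"
  by (subst ham_vf_antisym) (intro cont_linear_uminus cont_linear_ham_vf)

lemma ham_vf_mult: "ham_vf G (F * K) = ham_vf G F * K + F * ham_vf G K"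
  by (simp add: ham_vf_def dx_mult dy_mult sum_distrib_left sum_distrib_right algebra_simps
      sum.distrib sum_subtractf)

lemma partial_ham_vf:
  "dx i (ham_vf G F) = ham_vf (dx i G) F + ham_vf G (dx i F)"
  "dy i (ham_vf G F) = ham_vf (dy i G) F + ham_vf G (dy i F)"
  by (simp_all add: ham_vf_def partial_sum partial_diff dx_mult dy_mult partial_commute(3)
      partial_commute(1,2)[of i] sum.distrib sum_subtractf algebra_simps)

text \<open>In operator form: the commutator of two Hamiltonian fields is the field of the bracket.
  It serves both for commuting with the linear field and for the derivation property of
  \<open>ham_vf S\<close>.\<close>

lemma ham_vf_jacobi:
  "ham_vf G (ham_vf K F) = ham_vf (ham_vf G K) F + ham_vf K (ham_vf G F)"
proof -
  \<comment> \<open>After the Leibniz rule the second derivatives of \<open>G\<close> remain; they form an antisymmetric double sum.\<close>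
  define P where "P i j = dx j (dx i G) * dy j K * dy i F - dx i (dy j G) * dx j K * dy i F
     - dx j (dy i G) * dy j K * dx i F + dy j (dy i G) * dx j K * dx i F" for i j
  have "ham_vf (dx i G) K * dy i F - ham_vf (dy i G) K * dx i F
      + dx i K * ham_vf (dy i G) F - dy i K * ham_vf (dx i G) F = (\<Sum>j\<in>UNIV. P i j - P j i)" for i
    unfolding ham_vf_def P_def sum_distrib_left sum_distrib_right
      sum_subtractf[symmetric] sum.distrib[symmetric]
    by (rule sum.cong[OF refl])
       (simp only: partial_commute(1,2)[of _ i] partial_commute(3)[symmetric] algebra_simps)
  then have "(\<Sum>i\<in>UNIV. ham_vf (dx i G) K * dy i F - ham_vf (dy i G) K * dx i F
      + dx i K * ham_vf (dy i G) F - dy i K * ham_vf (dx i G) F) =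
      (\<Sum>i\<in>UNIV. \<Sum>j\<in>UNIV. P i j) - (\<Sum>i\<in>UNIV. \<Sum>j\<in>UNIV. P j i)"
    by (simp add: sum_subtractf)
  also have "\<dots> = 0" by (subst sum.swap) simp
  finally have zero: "(\<Sum>i\<in>UNIV. ham_vf (dx i G) K * dy i F - ham_vf (dy i G) K * dx i F
      + dx i K * ham_vf (dy i G) F - dy i K * ham_vf (dx i G) F) = 0" .
  have "ham_vf G (ham_vf K F) =
    (\<Sum>i\<in>UNIV. ham_vf G (dx i K) * dy i F + dx i K * ham_vf G (dy i F)
       - ham_vf G (dy i K) * dx i F - dy i K * ham_vf G (dx i F))"
    by (simp add: ham_vf_def[of K] cont_linear_sum cont_linear_diff cont_linear_ham_vf ham_vf_mult algebra_simps)
  moreover have "ham_vf (ham_vf G K) F + ham_vf K (ham_vf G F) =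
    (\<Sum>i\<in>UNIV. ham_vf G (dx i K) * dy i F + dx i K * ham_vf G (dy i F)
       - ham_vf G (dy i K) * dx i F - dy i K * ham_vf G (dx i F)) +
    (\<Sum>i\<in>UNIV. ham_vf (dx i G) K * dy i F - ham_vf (dy i G) K * dx i F
      + dx i K * ham_vf (dy i G) F - dy i K * ham_vf (dx i G) F)"
    unfolding ham_vf_def[of "ham_vf G K"] ham_vf_def[of K] partial_ham_vf
      sum.distrib[symmetric]
    by (rule sum.cong[OF refl]) (simp add: algebra_simps)
  ultimately show ?thesis using zero by simp
qed

section \<open>Coordinates, Euler operators and the linear field\<close>

lemma xycoeff_xvar: "xycoeff (xvar i) k = (if k = unit_x i then 1 else 0)"
  unfolding unit_x_def by transfer simp
lemma xycoeff_yvar: "xycoeff (yvar i) k = (if k = unit_y i then 1 else 0)"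
  unfolding unit_y_def by transfer simp

lemma xycoeff_monom_mult:
  assumes "\<And>k. xycoeff M k = (if k = e then 1 else 0)"
  shows "xycoeff (M * G) (q + e) = xycoeff G q"
    and "(\<And>q. k \<noteq> q + e) \<Longrightarrow> xycoeff (M * G) k = 0"
proof -
  have "(\<Sum>(p, r) | p + r = q + e. xycoeff M p * xycoeff G r) =
        (\<Sum>(p, r) \<in> {(e, q)}. xycoeff M p * xycoeff G r)"
  proof (rule sum.mono_neutral_right[OF finite_expo_split])
    show "{(e, q)} \<subseteq> {(p, r). p + r = q + e}" by (simp add: add.commute)
    show "\<forall>u\<in>{(p, r). p + r = q + e} - {(e, q)}. (case u of (p, r) \<Rightarrow> xycoeff M p * xycoeff G r) = 0"
    proof
      fix u assume u: "u \<in> {(p, r). p + r = q + e} - {(e, q)}"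
      then have "fst u + snd u = q + e" "u \<noteq> (e, q)" by auto
      then have "fst u \<noteq> e" by (metis add.commute add_right_cancel prod.collapse)
      then show "(case u of (p, r) \<Rightarrow> xycoeff M p * xycoeff G r) = 0"
        by (simp add: assms case_prod_unfold)
    qed
  qed
  then show "xycoeff (M * G) (q + e) = xycoeff G q" by (simp add: xycoeff_mult assms)
  assume k: "\<And>q. k \<noteq> q + e"
  show "xycoeff (M * G) k = 0"
    unfolding xycoeff_mult
  proof (intro sum.neutral ballI)
    fix u assume "u \<in> {(p, q). p + q = k}"
    then have "fst u \<noteq> e" using k[of "snd u"] by (auto simp: add.commute)
    then show "(case u of (p, q) \<Rightarrow> xycoeff M p * xycoeff G q) = 0"
      by (simp add: assms case_prod_unfold)
  qed
qed

lemma xycoeff_euler: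
  "xycoeff (xvar i * dx i F) k = of_nat (fst k $ i) * xycoeff F k"
  "xycoeff (yvar i * dy i F) k = of_nat (snd k $ i) * xycoeff F k"
proof -
  show "xycoeff (xvar i * dx i F) k = of_nat (fst k $ i) * xycoeff F k"
  proof (cases "fst k $ i > 0")
    case True
    then obtain q where "k = q + unit_x i" using unit_x_split by blast
    then show ?thesis by (simp add: xycoeff_dx xycoeff_monom_mult(1)[OF xycoeff_xvar])
  next
    case False
    then have "k \<noteq> q + unit_x i" for q by (auto simp: )
    then show ?thesis using xycoeff_monom_mult(2)[OF xycoeff_xvar, of k i] False by simp
  qed
  show "xycoeff (yvar i * dy i F) k = of_nat (snd k $ i) * xycoeff F k"
  proof (cases "snd k $ i > 0")
    case True
    then obtain q where "k = q + unit_y i" using unit_y_split by blast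
    then show ?thesis by (simp add: xycoeff_dy xycoeff_monom_mult(1)[OF xycoeff_yvar])
  next
    case False
    then have "k \<noteq> q + unit_y i" for q by (auto simp: )
    then show ?thesis using xycoeff_monom_mult(2)[OF xycoeff_yvar, of k i] False by simp
  qed
qed

text \<open>Monomials are eigenvectors of the Euler operators, hence of the linear field;
  \<open>weight\<close> is the eigenvalue, and this is the origin of the grading.\<close>

lemma xycoeff_X_lin: "xycoeff (X_lin lam F) k = weight lam k * xycoeff F k"
  by (simp add: X_lin_def xycoeff_sum xycoeff_euler weight_def sum_distrib_right sum_distrib_left
       algebra_simps sum_subtractf sum.distrib)

lemma partial_var:
  "dx i (xvar j) = (if i = j then 1 else 0)" "dy i (xvar j) = 0"
  "dx i (yvar j) = 0" "dy i (yvar j) = (if i = j then 1 else 0)"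
proof -
  have e: "n + unit_x i = unit_x j \<longleftrightarrow> n = 0 \<and> i = j" "n + unit_y i = unit_y j \<longleftrightarrow> n = 0 \<and> i = j"
    for n :: "'a expo" and i j
    by (auto simp: prod_eq_iff vec_eq_iff split: if_splits dest: spec[of _ i])
  have ne: "n + unit_x i \<noteq> unit_y j" "n + unit_y i \<noteq> unit_x j" for n :: "'a expo" and i j
    by (auto simp: prod_eq_iff vec_eq_iff dest: spec[of _ i])
  show "dx i (xvar j) = (if i = j then 1 else 0)" "dy i (xvar j) = 0"
    "dx i (yvar j) = 0" "dy i (yvar j) = (if i = j then 1 else 0)"
    by (rule xyseries_eqI, simp add: xycoeff_dx xycoeff_dy xycoeff_xvar xycoeff_yvar xycoeff_one e ne)+
qed

lemma ham_vf_var: "ham_vf G (yvar i) = dx i G" "ham_vf G (xvar i) = - dy i G"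
  by (simp_all add: ham_vf_def partial_var sum_negf if_distrib[of "\<lambda>x. _ * x"] cong: if_cong)

lemma ham_vf_quad_ham: "ham_vf (quad_ham lam) = X_lin lam"
proof
  fix F
  have "dx i (quad_ham lam) = lam $ i *\<^sub>c yvar i" "dy i (quad_ham lam) = lam $ i *\<^sub>c xvar i" for i
    by (simp_all add: quad_ham_def partial_sum partial_scale dx_mult dy_mult partial_var
        if_distrib[of "\<lambda>x. _ * x"] if_distrib[of "\<lambda>x. x * _"] if_distrib[of "\<lambda>x. _ *\<^sub>c x"]
        xyscale_simps cong: if_cong)
  then show "ham_vf (quad_ham lam) F = X_lin lam F"
    by (simp add: ham_vf_def X_lin_def xyscale_mult sum_subtractf)
qed

lemma xycoeff_quad_ham: "mdeg k \<noteq> 2 \<Longrightarrow> xycoeff (quad_ham lam) k = 0"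
proof -
  assume k: "mdeg k \<noteq> 2"
  have "xycoeff (xvar i * yvar i) k = 0" for i
    unfolding xycoeff_mult
  proof (rule sum.neutral, clarify)
    fix a b a' b' assume h: "k = (a, b) + (a', b')"
    have "\<not> ((a, b) = unit_x i \<and> (a', b') = unit_y i)"
      using k h mdeg_add[of "(a, b)" "(a', b')"] by auto
    then show "xycoeff (xvar i) (a, b) * xycoeff (yvar i) (a', b') = 0"
      by (auto simp: xycoeff_xvar xycoeff_yvar)
  qed
  then show ?thesis by (simp add: quad_ham_def xycoeff_sum)
qed

text \<open>Applying the field to the coordinates returns all partial derivatives of G, and every
  nonconstant coefficient shows up in one of them with a positive integer factor.\<close>

lemma ham_vf_inj:
  assumes "ham_vf G = ham_vf G'" "xycoeff G 0 = xycoeff G' 0"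
  shows "G = G'"
proof (rule xyseries_eqI)
  fix k :: "'a expo"
  have d: "dx i G = dx i G'" "dy i G = dy i G'" for i
    using ham_vf_var[of G i] ham_vf_var[of G' i] assms(1) by auto
  consider "k = 0" | i where "fst k $ i > 0" | i where "snd k $ i > 0"
    by (auto simp: prod_eq_iff vec_eq_iff)
  then show "xycoeff G k = xycoeff G' k"
  proof cases
    case (2 i)
    then obtain q where "k = q + unit_x i" using unit_x_split by blast
    then show ?thesis using xycoeff_dx[of i G q] xycoeff_dx[of i G' q] d by (metis mult_cancel_left of_nat_eq_0_iff nat.distinct(1))
  next
    case (3 i)
    then obtain q where "k = q + unit_y i" using unit_y_split by blast
    then show ?thesis using xycoeff_dy[of i G q] xycoeff_dy[of i G' q] d by (metis mult_cancel_left of_nat_eq_0_iff nat.distinct(1))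
  qed (use assms in simp)
qed

section \<open>The weight grading\<close>

lemma weight_add: "weight lam (p + q) = weight lam p + weight lam q"
  by (simp add: weight_def algebra_simps sum.distrib sum_subtractf)

lemma weight_unit_x: "weight lam (unit_x i) = - lam $ i" and weight_unit_y: "weight lam (unit_y i) = lam $ i"
proof -
  have "weight lam (unit_x i) = (\<Sum>j\<in>UNIV. if j = i then - lam $ i else 0)"
    "weight lam (unit_y i) = (\<Sum>j\<in>UNIV. if j = i then lam $ i else 0)"
    unfolding weight_def by (rule sum.cong, simp, simp)+
  then show "weight lam (unit_x i) = - lam $ i" "weight lam (unit_y i) = lam $ i" by simp_all
qed

lemma xycoeff_component:
  "xycoeff (component lam G w) k = (if mdeg k \<ge> 3 \<and> weight lam k = w then xycoeff G k else 0)"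
  by (simp add: component_def)

lemma vanish_component: "vanish 3 (component lam G w)"
  by (simp add: vanish_def xycoeff_component)

lemma locally_finite_component: "locally_finite (\<lambda>w. component lam G w) B"
  unfolding locally_finite_def
proof
  fix k
  show "finite {w \<in> B. xycoeff (component lam G w) k \<noteq> 0}"
    by (rule finite_subset[of _ "{weight lam k}"]) (auto simp: xycoeff_component split: if_splits)
qed

lemma xycoeff_infsum_component:
  "xycoeff (infsum (\<lambda>w. c w *\<^sub>c component lam G w) UNIV) k =
     (if mdeg k \<ge> 3 then c (weight lam k) * xycoeff G k else 0)"
  by (subst xycoeff_infsum_sum[where T = "{weight lam k}"])
     (auto simp: locally_finite_scale locally_finite_component xycoeff_component)

lemma X_lin_component: "X_lin lam (component lam G w) = w *\<^sub>c component lam G w"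
  by (rule xyseries_eqI) (simp add: xycoeff_X_lin xycoeff_component)

text \<open>By Jacobi the commutator is the field of \<open>X_lin lam\<close> applied to the
  component, and a component is an eigenvector with eigenvalue w.\<close>

lemma X_lin_commute_component:
  "X_lin lam (ham_vf (component lam G w) F) =
     w *\<^sub>c ham_vf (component lam G w) F + ham_vf (component lam G w) (X_lin lam F)"
  using ham_vf_jacobi[of "quad_ham lam" "component lam G w" F]
  by (simp add: ham_vf_quad_ham X_lin_component cont_linear_scale[OF cont_linear_ham_vf_left])

text \<open>Unlike \<open>component\<close> this keeps all degrees: it is the full projection onto a
  weight space, to be applied to arguments of operators.\<close>

definition weight_part :: "complex^'v::finite \<Rightarrow> complex \<Rightarrow> 'v xyseries \<Rightarrow> 'v xyseries" where
  "weight_part lam \<alpha> F = Abs_xyseries (\<lambda>k. if weight lam k = \<alpha> then xycoeff F k else 0)"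

text \<open>Phrasing the shift of weights by w through the continuous projections lets the property
  pass to infinite sums of operators.\<close>

definition homogeneous :: "complex^'v::finite \<Rightarrow> complex \<Rightarrow> 'v xyop \<Rightarrow> bool" where
  "homogeneous lam w L \<longleftrightarrow>
     (\<forall>\<alpha> F. L (weight_part lam \<alpha> F) = weight_part lam (\<alpha> + w) (L F))"

lemma xycoeff_weight_part:
  "xycoeff (weight_part lam \<alpha> F) k = (if weight lam k = \<alpha> then xycoeff F k else 0)"
  by (simp add: weight_part_def)

lemma homogeneous_comp:
  "homogeneous lam v L \<Longrightarrow> homogeneous lam w L' \<Longrightarrow> homogeneous lam (v + w) (L \<circ> L')"
  by (simp add: homogeneous_def add_ac)

text \<open>Differentiating in the i-th x-variable raises weights by \<open>lam $ i\<close> and in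
  the i-th y-variable lowers them by the same amount; every product in the bracket contains one of
  each.\<close>

lemma homogeneous_component: "homogeneous lam w (ham_vf (component lam G w))"
proof -
  let ?C = "component lam G w"
  have xy: "dx i ?C * dy i (weight_part lam \<alpha> F) = weight_part lam (\<alpha> + w) (dx i ?C * dy i F)" for \<alpha> F i
  proof (rule xyseries_eqI)
    fix k
    have "xycoeff (dx i ?C) p * xycoeff (dy i (weight_part lam \<alpha> F)) q =
       (if weight lam k = \<alpha> + w then xycoeff (dx i ?C) p * xycoeff (dy i F) q else 0)"
      if "p + q = k" for p q
      using that by (auto simp: xycoeff_dx xycoeff_dy xycoeff_component xycoeff_weight_part
          weight_add weight_unit_x weight_unit_y)
    then show "xycoeff (dx i ?C * dy i (weight_part lam \<alpha> F)) k =
        xycoeff (weight_part lam (\<alpha> + w) (dx i ?C * dy i F)) k"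
      unfolding xycoeff_weight_part xycoeff_mult
      by (simp add: case_prod_unfold)
  qed
  have yx: "dy i ?C * dx i (weight_part lam \<alpha> F) = weight_part lam (\<alpha> + w) (dy i ?C * dx i F)" for \<alpha> F i
  proof (rule xyseries_eqI)
    fix k
    have "xycoeff (dy i ?C) p * xycoeff (dx i (weight_part lam \<alpha> F)) q =
       (if weight lam k = \<alpha> + w then xycoeff (dy i ?C) p * xycoeff (dx i F) q else 0)"
      if "p + q = k" for p q
      using that by (auto simp: xycoeff_dx xycoeff_dy xycoeff_component xycoeff_weight_part
          weight_add weight_unit_x weight_unit_y)
    then show "xycoeff (dy i ?C * dx i (weight_part lam \<alpha> F)) k =
        xycoeff (weight_part lam (\<alpha> + w) (dy i ?C * dx i F)) k"
      unfolding xycoeff_weight_part xycoeff_mult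
      by (simp add: case_prod_unfold)
  qed
  show ?thesis
    unfolding homogeneous_def ham_vf_def xy yx
    by (auto intro!: xyseries_eqI simp: xycoeff_weight_part xycoeff_sum)
qed

section \<open>Contraction of moulds with a family of operators\<close>

definition words :: "(complex \<Rightarrow> 'v::finite xyop) \<Rightarrow> complex list \<Rightarrow> 'v xyop" where
  "words D ws = foldr (\<lambda>w P. D w \<circ> P) ws id"

lemma words_simps [simp]: "words D [] F = F" "words D (w # ws) F = D w (words D ws F)"
  by (simp_all add: words_def)

lemma words_Nil: "words D [] = id" and words_Cons: "words D (w # ws) = D w \<circ> words D ws"
  by (simp_all add: words_def)

lemma words_append: "words D (u @ v) F = words D u (words D v F)"
  by (induction u) simp_all

text \<open>The sum runs over all complex words. For a Hamiltonian, letters outside \<Omega> carry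
  the zero operator, so the mould calculus need not track the alphabet.\<close>

definition contract :: "(complex \<Rightarrow> 'v::finite xyop) \<Rightarrow> mould \<Rightarrow> 'v xyop" where
  "contract D M F = (\<Sum>\<^sub>\<infinity>ws. M ws *\<^sub>c words D ws F)"

section \<open>Finiteness of splittings and factorizations of a word\<close>

lemma finite_splits: "finite {(u, v). u @ v = ws}"
proof (rule finite_subset)
  show "{(u, v). u @ v = ws} \<subseteq> (\<lambda>n. (take n ws, drop n ws)) ` {..length ws}"
  proof
    fix x assume "x \<in> {(u, v). u @ v = ws}"
    then obtain u v where "x = (u, v)" "u @ v = ws" by auto
    then show "x \<in> (\<lambda>n. (take n ws, drop n ws)) ` {..length ws}"
      by (intro image_eqI[of _ _ "length u"]) auto
  qed
qed simp

lemma length_le_concat: "[] \<notin> set us \<Longrightarrow> length us \<le> length (concat us)"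
proof (induction us)
  case (Cons u us)
  then show ?case by (cases u) auto
qed simp

lemma finite_factorizations: "finite {us. concat us = ws \<and> [] \<notin> set us}"
proof (rule finite_subset)
  let ?U = "{u. set u \<subseteq> set ws \<and> length u \<le> length ws}"
  show "finite {us. set us \<subseteq> ?U \<and> length us \<le> length ws}"
    by (intro finite_lists_length_le) simp
  show "{us. concat us = ws \<and> [] \<notin> set us} \<subseteq> {us. set us \<subseteq> ?U \<and> length us \<le> length ws}"
    using length_le_concat by (fastforce simp: length_concat intro: member_le_sum_list)
qed

text \<open>The number of blocks is determined by the factorization, so grouping by it can be
  undone; the empty word has just the empty factorization, which absorbs the separate case.\<close>

lemma mould_comp_eq:
  "(M \<circ>\<^sub>m N) ws = (\<Sum>us | concat us = ws \<and> [] \<notin> set us. M (map sum_list us) * prod_list (map N us))"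
proof (cases "ws = []")
  case True
  have "{us. concat us = [] \<and> [] \<notin> set us} = {[] :: complex list list}"
    by (auto simp: concat_eq_Nil_conv) (metis list.set_intros(1) neq_Nil_conv)
  then show ?thesis using True by (simp add: mould_comp_def)
next
  case False
  have "(\<Sum>us | concat us = ws \<and> [] \<notin> set us. M (map sum_list us) * prod_list (map N us)) =
    (\<Sum>k\<in>{1..length ws}. \<Sum>us\<in>{us \<in> {us. concat us = ws \<and> [] \<notin> set us}. length us = k}.
        M (map sum_list us) * prod_list (map N us))"
  proof (rule sum.group[OF finite_factorizations, symmetric])
    show "length ` {us. concat us = ws \<and> [] \<notin> set us} \<subseteq> {1..length ws}"
      using False length_le_concat by (fastforce simp: Suc_le_eq)
  qed simp
  also have "\<dots> = (M \<circ>\<^sub>m N) ws"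
    unfolding mould_comp_def using False
    by (auto intro!: sum.cong)
  finally show ?thesis by simp
qed

text \<open>The second assumption makes long words act only in high degree, the third leaves
  finitely many letters visible below any degree. Together, only finitely many words reach a given
  coefficient.\<close>

locale letter_ops =
  fixes D :: "complex \<Rightarrow> 'v::finite xyop"
  assumes cont_linear_letter: "cont_linear (D w)"
    and raises_letter: "raises 1 (D w)"
    and finite_letters: "finite {w. \<not> raises N (D w)}"
begin

lemma cont_linear_words: "cont_linear (words D ws)"
  by (induction ws) (simp_all only: words_Nil words_Cons cont_linear_id cont_linear_comp cont_linear_letter)

lemma raises_words_length: "raises (length ws) (words D ws)"
proof (induction ws)
  case (Cons w ws)
  then have "raises (1 + length ws) (words D (w # ws))"
    unfolding words_Cons by (intro raises_comp raises_letter)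
  then show ?case by (simp del: words_simps)
qed (simp add: words_Nil raises_def)

lemma raises_words_letter: "w \<in> set ws \<Longrightarrow> raises N (D w) \<Longrightarrow> raises N (words D ws)"
proof (induction ws)
  case (Cons v ws)
  show ?case
  proof (cases "w = v")
    case True
    then have "raises (N + length ws) (words D (v # ws))"
      unfolding words_Cons using Cons.prems raises_words_length by (intro raises_comp) auto
    then show ?thesis by (rule raises_mono) simp
  next
    case False
    then have "raises (1 + N) (words D (v # ws))"
      unfolding words_Cons using Cons raises_letter by (intro raises_comp) auto
    then show ?thesis by (rule raises_mono) simp
  qed
qed simp

lemma finite_words: "finite {ws. \<not> raises N (words D ws)}"
proof (rule finite_subset)
  show "finite {ws. set ws \<subseteq> {w. \<not> raises N (D w)} \<and> length ws \<le> N}"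
    by (rule finite_lists_length_le[OF finite_letters])
  show "{ws. \<not> raises N (words D ws)} \<subseteq> {ws. set ws \<subseteq> {w. \<not> raises N (D w)} \<and> length ws \<le> N}"
    using raises_words_letter raises_mono[OF raises_words_length] by (auto simp: not_le) (meson nat_le_linear)
qed

text \<open>Indices need not be words: pairs of words, powers and factorizations all occur. It
  suffices that each word is reached by finitely many indices with nonzero coefficient.\<close>

lemma locally_finite_words:
  assumes "\<And>ws. finite {i \<in> A. c i \<noteq> 0 \<and> g i = ws}"
  shows "locally_finite (\<lambda>i. c i *\<^sub>c words D (g i) F) A"
  unfolding locally_finite_def
proof
  fix k
  show "finite {i \<in> A. xycoeff (c i *\<^sub>c words D (g i) F) k \<noteq> 0}"
  proof (rule finite_subset)
    let ?W = "{ws. \<not> raises (Suc (mdeg k)) (words D ws)}"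
    show "finite (\<Union>ws\<in>?W. {i \<in> A. c i \<noteq> 0 \<and> g i = ws})"
      using assms finite_words by blast
    have "xycoeff (words D ws F) k = 0" if "ws \<notin> ?W" for ws
      using that raisesD[of "Suc (mdeg k)" "words D ws" 0 F] vanishD[of "Suc (mdeg k)" "words D ws F" k] by auto
    then show "{i \<in> A. xycoeff (c i *\<^sub>c words D (g i) F) k \<noteq> 0} \<subseteq>
        (\<Union>ws\<in>?W. {i \<in> A. c i \<noteq> 0 \<and> g i = ws})" by auto
  qed
qed

lemma locally_finite_words': "locally_finite (\<lambda>ws. c ws *\<^sub>c words D ws F) A"
  using locally_finite_words[of A c "\<lambda>ws. ws" F] by (auto intro: finite_subset[of _ "{ws}" for ws])

lemma words_infsum:
  assumes "locally_finite (\<lambda>i. c i *\<^sub>c words D (g i) F) A"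
  shows "m *\<^sub>c words D u (infsum (\<lambda>i. c i *\<^sub>c words D (g i) F) A) =
         infsum (\<lambda>i. (m * c i) *\<^sub>c words D (u @ g i) F) A"
  using infsum_locally_finite_scale[OF cont_linear_infsum(1)[OF cont_linear_words assms], of m u]
  by (simp add: cont_linear_infsum(2)[OF cont_linear_words assms] cont_linear_scale[OF cont_linear_words] words_append xyscale_simps)

text \<open>The common last step of the product, exponential and composition formulas: all indices
  giving the same word are merged, and their total coefficient is the value of the resulting
  mould.\<close>

lemma infsum_words_collect:
  assumes fin: "\<And>ws. finite {i \<in> A. c i \<noteq> 0 \<and> g i = ws}" and "g ` A \<subseteq> B"
  shows "infsum (\<lambda>i. c i *\<^sub>c words D (g i) F) A =
         infsum (\<lambda>ws. infsum c {i \<in> A. g i = ws} *\<^sub>c words D ws F) B"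
  unfolding infsum_locally_finite_fibres(2)[OF locally_finite_words[OF fin] assms(2)]
proof (rule infsum_cong)
  fix ws
  have "infsum (\<lambda>i. c i *\<^sub>c words D (g i) F) {i \<in> A. g i = ws} =
        infsum (\<lambda>i. c i *\<^sub>c words D ws F) {i \<in> A. c i \<noteq> 0 \<and> g i = ws}"
    by (rule infsum_cong_neutral) (auto simp: xyscale_simps)
  also have "\<dots> = (\<Sum>i | i \<in> A \<and> c i \<noteq> 0 \<and> g i = ws. c i) *\<^sub>c words D ws F"
    by (simp add: fin xyscale_sum_left)
  also have "(\<Sum>i | i \<in> A \<and> c i \<noteq> 0 \<and> g i = ws. c i) = infsum c {i \<in> A. c i \<noteq> 0 \<and> g i = ws}"
    by (simp add: fin)
  also have "\<dots> = infsum c {i \<in> A. g i = ws}"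
    by (rule infsum_cong_neutral) auto
  finally show "infsum (\<lambda>i. c i *\<^sub>c words D (g i) F) {i \<in> A. g i = ws} =
      infsum c {i \<in> A. g i = ws} *\<^sub>c words D ws F" .
qed

text \<open>Concatenating words composes their operators, so the double sum collects, at each word,
  exactly its splittings into two factors.\<close>

lemma contract_mult: "contract D (M \<times>\<^sub>m N) F = contract D M (contract D N F)"
proof -
  have fin: "finite {u \<in> UNIV. M (fst u) * N (snd u) \<noteq> 0 \<and> fst u @ snd u = ws}" for ws
    by (rule finite_subset[OF _ finite_splits[of ws]]) auto
  note lf = locally_finite_words[OF fin, of F]
  have inner: "infsum (\<lambda>u. M (fst u) * N (snd u)) {u \<in> UNIV. fst u @ snd u = ws} = (M \<times>\<^sub>m N) ws" for ws
    using finite_splits[of ws] by (simp add: mould_mult_def case_prod_unfold)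
  have "contract D M (contract D N F) =
      infsum (\<lambda>u. infsum (\<lambda>v. (M u * N v) *\<^sub>c words D (u @ v) F) UNIV) UNIV"
    unfolding contract_def by (simp add: words_infsum[OF locally_finite_words'])
  also have "\<dots> = infsum (\<lambda>u. (M (fst u) * N (snd u)) *\<^sub>c words D (fst u @ snd u) F) UNIV"
    using infsum_locally_finite_Sigma(3)[of "\<lambda>u v. (M u * N v) *\<^sub>c words D (u @ v) F" UNIV "\<lambda>_. UNIV"] lf
    by (simp add: case_prod_unfold)
  also have "\<dots> = infsum (\<lambda>ws. infsum (\<lambda>u. M (fst u) * N (snd u)) {u \<in> UNIV. fst u @ snd u = ws}
      *\<^sub>c words D ws F) UNIV"
    by (rule infsum_words_collect[OF fin]) simp
  finally show ?thesis by (simp only: inner contract_def)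
qed

lemma contract_one: "contract D mould_one F = F"
proof -
  have "contract D mould_one F = infsum (\<lambda>ws. mould_one ws *\<^sub>c words D ws F) {[]}"
    unfolding contract_def by (rule infsum_cong_neutral) (auto simp: mould_one_def xyscale_simps)
  then show ?thesis by (simp add: mould_one_def xyscale_simps)
qed

lemma contract_power: "(contract D M ^^ k) F = contract D (mould_power M k) F"
  by (induction k) (simp_all add: contract_one contract_mult)

lemma contract_diff: "contract D (\<lambda>ws. M ws - N ws) F = contract D M F - contract D N F"
  unfolding contract_def by (simp add: xyscale_simps infsum_locally_finite_diff locally_finite_words')

lemma contract_minus: "contract D (\<lambda>ws. - M ws) F = - contract D M F"
  unfolding contract_def using infsum_locally_finite_scale[OF locally_finite_words', of "- 1" M F UNIV]
  by (simp add: xyscale_simps)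

text \<open>Without a constant term the k-th power vanishes on words shorter than k. Hence the
  exponential series is finite at each word, and powers and words can be summed in either
  order.\<close>

lemma contract_exp:
  assumes "M [] = 0"
  shows "opexp (contract D M) F = contract D (mould_exp M) F"
proof -
  have pow0: "mould_power M k ws = 0" if "length ws < k" for k ws
    using that
  proof (induction k arbitrary: ws)
    case (Suc k)
    have "M u * mould_power M k v = 0" if "u @ v = ws" for u v
      using that Suc assms by (cases u) auto
    then show ?case by (simp add: mould_mult_def case_prod_unfold sum.neutral)
  qed simp
  let ?c = "\<lambda>u. mould_power M (fst u) (snd u) / fact (fst u)"
  have fin: "finite {u \<in> UNIV. ?c u \<noteq> 0 \<and> snd u = ws}" for ws
    by (rule finite_subset[of _ "{..length ws} \<times> {ws}"]) (auto simp: not_less[symmetric] pow0)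
  note lf = locally_finite_words[OF fin, of F]
  have lf': "locally_finite (\<lambda>(k, ws). (mould_power M k ws / fact k) *\<^sub>c words D ws F) (UNIV \<times> UNIV)"
    using lf by (simp add: case_prod_unfold)
  have step: "(1 / fact k) *\<^sub>c (contract D M ^^ k) F =
      infsum (\<lambda>ws. (mould_power M k ws / fact k) *\<^sub>c words D ws F) UNIV" for k
    unfolding contract_power contract_def
    by (simp add: locally_finite_words' xyscale_simps flip: infsum_locally_finite_scale)
  have inner: "infsum ?c {u \<in> UNIV. snd u = ws} = mould_exp M ws" for ws
  proof -
    have "infsum ?c {u \<in> UNIV. snd u = ws} = infsum ?c ((\<lambda>k. (k, ws)) ` {..length ws})"
      by (rule infsum_cong_neutral) (auto simp: not_le image_iff Ball_def intro!: pow0)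
    also have "\<dots> = (\<Sum>k\<le>length ws. mould_power M k ws / fact k)"
      by (subst infsum_reindex) (auto simp: inj_on_def)
    also have "\<dots> = mould_exp M ws"
      unfolding mould_exp_def by (rule suminf_finite[symmetric]) (auto simp: not_le pow0)
    finally show ?thesis .
  qed
  have "opexp (contract D M) F = infsum (\<lambda>k. infsum (\<lambda>ws. (mould_power M k ws / fact k) *\<^sub>c words D ws F) UNIV) UNIV"
    unfolding opexp_def step by (rule suminf_locally_finite) (rule infsum_locally_finite_Sigma(2)[OF lf'])
  also have "\<dots> = infsum (\<lambda>u. ?c u *\<^sub>c words D (snd u) F) UNIV"
    using infsum_locally_finite_Sigma(3)[OF lf'] by (simp add: case_prod_unfold)
  also have "\<dots> = infsum (\<lambda>ws. infsum ?c {u \<in> UNIV. snd u = ws} *\<^sub>c words D ws F) UNIV"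
    by (rule infsum_words_collect[OF fin]) simp
  finally show ?thesis by (simp only: inner contract_def)
qed

text \<open>Moving X to the right past a word picks up each letter once as a scalar, in total the
  sum of the word.\<close>

lemma contract_nabla:
  assumes "cont_linear X" and X: "\<And>w F. X (D w F) = w *\<^sub>c D w F + D w (X F)"
  shows "X (contract D M F) = contract D (mould_nabla M) F + contract D M (X F)"
proof -
  have words: "X (words D ws F) = sum_list ws *\<^sub>c words D ws F + words D ws (X F)" for ws
    by (induction ws)
       (simp_all add: X xyscale_simps cont_linear_add[OF cont_linear_letter] cont_linear_scale[OF cont_linear_letter])
  have "X (contract D M F) = infsum (\<lambda>ws. mould_nabla M ws *\<^sub>c words D ws F + M ws *\<^sub>c words D ws (X F)) UNIV"
    unfolding contract_def cont_linear_infsum(2)[OF \<open>cont_linear X\<close> locally_finite_words'] cont_linear_scale[OF \<open>cont_linear X\<close>] words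
    by (simp add: mould_nabla_def xyscale_simps mult.commute)
  then show ?thesis by (simp add: infsum_locally_finite_add locally_finite_words' contract_def)
qed

context
  fixes N :: mould and E :: "complex \<Rightarrow> 'v xyop"
  assumes N_Nil: "N [] = 0"
    and E: "\<And>w F. E w F = infsum (\<lambda>ws. N ws *\<^sub>c words D ws F) {ws. sum_list ws = w}"
begin

lemma finite_factorization_support:
  "finite {us \<in> A. M us * prod_list (map N us) \<noteq> 0 \<and> concat us = ws}"
proof (rule finite_subset[OF _ finite_factorizations[of ws]])
  have "prod_list (map N us) = 0" if "[] \<in> set us" for us
    using that N_Nil by (auto simp: prod_list_zero_iff image_iff)
  then show "{us \<in> A. M us * prod_list (map N us) \<noteq> 0 \<and> concat us = ws}
      \<subseteq> {us. concat us = ws \<and> [] \<notin> set us}" by auto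
qed

lemma words_comp:
  "words E u F = infsum (\<lambda>us. prod_list (map N us) *\<^sub>c words D (concat us) F) {us. map sum_list us = u}"
proof (induction u)
  case Nil
  then show ?case by (simp add: xyscale_simps)
next
  case (Cons w u)
  let ?A = "{ws. sum_list ws = w}" and ?B = "{us :: complex list list. map sum_list us = u}"
  let ?C = "\<lambda>x :: complex list \<times> complex list list. fst x # snd x"
  have inj: "inj_on ?C (?A \<times> ?B)" by (auto simp: inj_on_def)
  have img: "?C ` (?A \<times> ?B) = {us. map sum_list us = w # u}"
    by (force simp: image_iff map_eq_Cons_conv)
  have lf: "locally_finite (\<lambda>us. prod_list (map N us) *\<^sub>c words D (concat us) F) A" for A
    using locally_finite_words[OF finite_factorization_support[where M = "\<lambda>_. 1"]] by simp
  have lf': "locally_finite (\<lambda>(ws, us). (N ws * prod_list (map N us)) *\<^sub>c words D (ws @ concat us) F) (?A \<times> ?B)"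
    using lf[of "?C ` (?A \<times> ?B)"] unfolding locally_finite_reindex[OF inj] by (simp add: case_prod_unfold)
  have "words E (w # u) F = infsum (\<lambda>ws. infsum (\<lambda>us. (N ws * prod_list (map N us)) *\<^sub>c
      words D (ws @ concat us) F) ?B) ?A"
    by (simp add: Cons E words_infsum[OF lf])
  also have "\<dots> = infsum (\<lambda>us. prod_list (map N us) *\<^sub>c words D (concat us) F) (?C ` (?A \<times> ?B))"
    unfolding infsum_locally_finite_Sigma(3)[OF lf'] infsum_reindex[OF inj] by (simp add: o_def case_prod_unfold)
  finally show ?case unfolding img .
qed

text \<open>Replacing letters by blocks preserves the total sum, so the identity holds in each
  weight separately; this refined form is what an iteration over letters requires.\<close>

lemma infsum_words_comp:
  "infsum (\<lambda>u. M u *\<^sub>c words E u F) {u. sum_list u = w} =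
   infsum (\<lambda>ws. (M \<circ>\<^sub>m N) ws *\<^sub>c words D ws F) {ws. sum_list ws = w}"
proof -
  let ?U = "{u. sum_list u = w}" and ?B = "\<lambda>u. {us :: complex list list. map sum_list us = u}"
  let ?A = "{us. sum_list (map sum_list us) = w}"
  let ?C = "\<lambda>us. (map sum_list us, us)"
  let ?c = "\<lambda>us. M (map sum_list us) * prod_list (map N us)"
  have sum: "sum_list (map sum_list us) = sum_list (concat us)" for us :: "complex list list"
    by (induction us) auto
  have inj: "inj_on ?C ?A" by (auto simp: inj_on_def)
  have img: "?C ` ?A = Sigma ?U ?B" by (auto simp: image_iff)
  have fin: "finite {us \<in> A. ?c us \<noteq> 0 \<and> concat us = ws}" for A ws
    by (rule finite_factorization_support)
  note lf = locally_finite_words[OF fin, where F = F]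
  have lf': "locally_finite (\<lambda>(u, us). (M u * prod_list (map N us)) *\<^sub>c words D (concat us) F) (Sigma ?U ?B)"
    unfolding img[symmetric] locally_finite_reindex[OF inj] using lf by simp
  have lf1: "locally_finite (\<lambda>us. prod_list (map N us) *\<^sub>c words D (concat us) F) A" for A
    using locally_finite_words[OF finite_factorization_support[where M = "\<lambda>_. 1"]] by simp
  have "infsum (\<lambda>u. M u *\<^sub>c words E u F) ?U =
      infsum (\<lambda>u. infsum (\<lambda>us. (M u * prod_list (map N us)) *\<^sub>c words D (concat us) F) (?B u)) ?U"
    by (simp add: words_comp lf1 xyscale_simps flip: infsum_locally_finite_scale)
  also have "\<dots> = infsum (\<lambda>us. ?c us *\<^sub>c words D (concat us) F) ?A"
    unfolding infsum_locally_finite_Sigma(3)[OF lf'] unfolding img[symmetric] infsum_reindex[OF inj]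
    by (simp add: o_def)
  also have "\<dots> = infsum (\<lambda>ws. infsum ?c {us \<in> ?A. concat us = ws} *\<^sub>c words D ws F) {ws. sum_list ws = w}"
    by (rule infsum_words_collect[OF fin]) (auto simp: sum)
  \<comment> \<open>Lists with an empty block contain the factor N [] = 0; what remains over each
    word are its factorizations into nonempty blocks.\<close>
  also have "\<dots> = infsum (\<lambda>ws. (M \<circ>\<^sub>m N) ws *\<^sub>c words D ws F) {ws. sum_list ws = w}"
  proof (rule infsum_cong)
    fix ws :: "complex list" assume "ws \<in> {ws. sum_list ws = w}"
    then have "infsum ?c {us \<in> ?A. concat us = ws} = infsum ?c {us. concat us = ws \<and> [] \<notin> set us}"
      using N_Nil by (intro infsum_cong_neutral) (auto simp: sum prod_list_zero_iff image_iff)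
    then show "infsum ?c {us \<in> ?A. concat us = ws} *\<^sub>c words D ws F = (M \<circ>\<^sub>m N) ws *\<^sub>c words D ws F"
      by (simp add: mould_comp_eq finite_factorizations)
  qed
  finally show ?thesis .
qed

end

end

section \<open>Exponentials of derivations\<close>

lemma raises_funpow: "raises 1 V \<Longrightarrow> raises k (V ^^ k)"
proof (induction k)
  case (Suc k)
  then have "raises (1 + k) (V \<circ> V ^^ k)" by (intro raises_comp)
  then show ?case by (simp only: funpow.simps plus_1_eq_Suc)
qed (simp add: raises_def)

lemma cont_linear_funpow: "cont_linear V \<Longrightarrow> cont_linear (V ^^ k)"
  by (induction k) (simp_all add: cont_linear_id cont_linear_comp flip: id_def)

lemma xycoeff_funpow_nonzero:
  assumes V: "raises 1 V" and nz: "xycoeff ((V ^^ k) F) j \<noteq> 0"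
  shows "k \<le> mdeg j"
proof (rule ccontr)
  assume "\<not> k \<le> mdeg j"
  moreover have "vanish (0 + k) ((V ^^ k) F)" by (rule raisesD[OF raises_funpow[OF V] vanish_0(1)])
  ultimately show False using nz vanishD[of "0 + k" "(V ^^ k) F" j] by simp
qed

lemma locally_finite_opexp:
  assumes "raises 1 V"
  shows "locally_finite (\<lambda>k. c k *\<^sub>c (V ^^ k) F) A"
  unfolding locally_finite_def
proof
  fix j
  show "finite {k \<in> A. xycoeff (c k *\<^sub>c (V ^^ k) F) j \<noteq> 0}"
    by (rule finite_subset[of _ "{..mdeg j}"]) (auto dest: xycoeff_funpow_nonzero[OF assms])
qed

lemma opexp_eq_infsum: "raises 1 V \<Longrightarrow> opexp V F = infsum (\<lambda>k. (1 / fact k) *\<^sub>c (V ^^ k) F) UNIV"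
  unfolding opexp_def by (rule suminf_locally_finite) (rule locally_finite_opexp)

lemma infsum_locally_finite_diagonal:
  assumes "locally_finite (\<lambda>(i, j). f i j) (UNIV \<times> UNIV)"
  shows "infsum (\<lambda>i. infsum (f i) UNIV) UNIV = infsum (\<lambda>n. \<Sum>i\<le>n. f i (n - i)) (UNIV :: nat set)"
proof -
  have "infsum (\<lambda>i. infsum (f i) UNIV) UNIV = infsum (\<lambda>(i, j). f i j) (UNIV \<times> UNIV)"
    by (rule infsum_locally_finite_Sigma(3)[OF assms])
  also have "\<dots> = infsum (\<lambda>n. infsum (\<lambda>(i, j). f i j) {u \<in> UNIV \<times> UNIV. fst u + snd u = n}) UNIV"
    by (rule infsum_locally_finite_fibres(2)[OF assms]) simp
  also have "\<dots> = infsum (\<lambda>n. \<Sum>i\<le>n. f i (n - i)) UNIV"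
  proof (rule infsum_cong)
    fix n :: nat
    have eq: "{u \<in> UNIV \<times> UNIV. fst u + snd u = n} = (\<lambda>i. (i, n - i)) ` {..n}"
      by (auto simp: image_iff)
    show "infsum (\<lambda>(i, j). f i j) {u \<in> UNIV \<times> UNIV. fst u + snd u = n} = (\<Sum>i\<le>n. f i (n - i))"
      unfolding eq by (simp add: sum.reindex inj_on_def)
  qed
  finally show ?thesis .
qed

text \<open>On the n-th diagonal of the double sum the coefficient is (1 - 1)^n / n!, which leaves
  only n = 0.\<close>

lemma opexp_inverse:
  assumes V: "cont_linear V" "raises 1 V"
  shows "opexp V (opexp (\<lambda>F. - V F) F) = F"
proof -
  have pow: "((\<lambda>F. - V F) ^^ j) F = (- 1) ^ j *\<^sub>c (V ^^ j) F" for j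
    by (induction j) (simp_all add: xyscale_simps cont_linear_scale[OF V(1)])
  have neg: "raises 1 (\<lambda>F. - V F)" using V(2) by (simp add: raises_def vanish_def)
  let ?f = "\<lambda>i j. ((1 / fact i) * ((- 1) ^ j / fact j)) *\<^sub>c (V ^^ (i + j)) F"
  have lf: "locally_finite (\<lambda>(i, j). ?f i j) (UNIV \<times> UNIV)"
    unfolding locally_finite_def
  proof
    fix k
    show "finite {u \<in> UNIV \<times> UNIV. xycoeff (case u of (i, j) \<Rightarrow> ?f i j) k \<noteq> 0}"
      by (rule finite_subset[of _ "{..mdeg k} \<times> {..mdeg k}"]) (auto dest!: xycoeff_funpow_nonzero[OF V(2)])
  qed
  have "opexp V (opexp (\<lambda>F. - V F) F) = infsum (\<lambda>i. infsum (\<lambda>j. ?f i j) UNIV) UNIV"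
    unfolding opexp_eq_infsum[OF V(2)] opexp_eq_infsum[OF neg] pow xyscale_simps
    by (simp add: cont_linear_infsum(2)[OF cont_linear_funpow[OF V(1)] locally_finite_opexp[OF V(2)]]
       cont_linear_scale[OF cont_linear_funpow[OF V(1)]] funpow_add locally_finite_opexp[OF V(2)] xyscale_simps
       cont_linear_infsum(1)[OF cont_linear_funpow[OF V(1)] locally_finite_opexp[OF V(2)], unfolded cont_linear_scale[OF cont_linear_funpow[OF V(1)]]]
       flip: infsum_locally_finite_scale)
  also have "\<dots> = infsum (\<lambda>n. \<Sum>i\<le>n. ?f i (n - i)) UNIV"
    by (rule infsum_locally_finite_diagonal[OF lf])
  also have "\<dots> = infsum (\<lambda>n. \<Sum>i\<le>n. ?f i (n - i)) {0}"
  proof (rule infsum_cong_neutral)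
    fix n :: nat assume "n \<in> UNIV - {0}"
    have "(\<Sum>i\<le>n. (1 / fact i) * ((- 1) ^ (n - i) / fact (n - i))) =
        (\<Sum>i\<le>n. of_nat (n choose i) * 1 ^ i * (- 1) ^ (n - i)) / (fact n :: complex)"
      by (simp add: sum_divide_distrib binomial_fact)
    also have "\<dots> = (1 + - 1) ^ n / fact n" by (simp only: binomial_ring)
    also have "\<dots> = 0" using \<open>n \<in> UNIV - {0}\<close> by simp
    finally show "(\<Sum>i\<le>n. ?f i (n - i)) = 0"
      by (simp add: xyscale_simps flip: xyscale_sum_left)
  qed auto
  finally show ?thesis by (simp add: xyscale_simps)
qed

text \<open>The exponential of a derivation respects any continuous bilinear pairing; d bounds the
  degrees that the pairing may lose, and is 2 for the Poisson bracket.\<close>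

lemma opexp_pairing:
  assumes V: "cont_linear V" "raises 1 V"
    and b: "\<And>F. cont_linear (b F)" "\<And>G. cont_linear (\<lambda>F. b F G)"
    and van: "\<And>M N F G. vanish M F \<Longrightarrow> vanish N G \<Longrightarrow> vanish (M + N - d) (b F G)"
    and der: "\<And>F G. V (b F G) = b (V F) G + b F (V G)"
  shows "opexp V (b F G) = b (opexp V F) (opexp V G)"
proof -
  \<comment> \<open>With divided powers the iterated Leibniz rule loses its binomial coefficients
    and becomes the plain convolution \<open>diag\<close>.\<close>
  define e where "e n F = (1 / fact n) *\<^sub>c (V ^^ n) F" for n F
  have e_Suc: "V (e n F) = of_nat (Suc n) *\<^sub>c e (Suc n) F" for n F
    by (simp add: e_def cont_linear_scale[OF V(1)] xyscale_simps fact_Suc del: of_nat_Suc)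
  have van_e: "vanish n (e n F)" for n F
    using raisesD[OF raises_funpow[OF V(2)], of 0 F n] by (simp add: e_def vanish_scale)
  have lf_e: "locally_finite (\<lambda>n. e n F) UNIV" for F
    unfolding e_def by (rule locally_finite_opexp[OF V(2)])
  have lf: "locally_finite (\<lambda>(i, j). b (e i F) (e j G)) (UNIV \<times> UNIV)"
    unfolding locally_finite_def
  proof
    fix k
    have le: "i + j \<le> mdeg k + d" if "xycoeff (b (e i F) (e j G)) k \<noteq> 0" for i j
    proof (rule ccontr)
      assume "\<not> i + j \<le> mdeg k + d"
      then have "mdeg k < i + j - d" by simp
      then show False using vanishD[OF van[OF van_e[of i F] van_e[of j G]]] that by blast
    qed
    show "finite {u \<in> UNIV \<times> UNIV. xycoeff (case u of (i, j) \<Rightarrow> b (e i F) (e j G)) k \<noteq> 0}"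
      by (rule finite_subset[of _ "{..mdeg k + d} \<times> {..mdeg k + d}"]) (auto dest!: le)
  qed
  have diag: "(\<Sum>i\<le>n. b (e i F) (e (n - i) G)) = e n (b F G)" for n
  proof (induction n)
    case 0
    then show ?case by (simp add: e_def xyscale_simps)
  next
    case (Suc n)
    let ?t = "\<lambda>i. b (e i F) (e (Suc n - i) G)"
    have "of_nat (Suc n) *\<^sub>c e (Suc n) (b F G) = V (\<Sum>i\<le>n. b (e i F) (e (n - i) G))"
      by (simp only: e_Suc Suc)
    \<comment> \<open>Raising the left index gives the factor i + 1, raising the right one n + 1 -
      i. After a shift both sums run to n + 1, the added terms having factor 0, and the factors i
      and n + 1 - i add up to n + 1.\<close>
    also have "\<dots> = (\<Sum>i\<le>n. of_nat (Suc i) *\<^sub>c ?t (Suc i)) + (\<Sum>i\<le>n. of_nat (Suc n - i) *\<^sub>c ?t i)"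
      by (simp add: cont_linear_sum[OF V(1)] der e_Suc cont_linear_scale[OF b(1)] cont_linear_scale[OF b(2)]
          sum.distrib Suc_diff_le del: of_nat_Suc)
    also have "(\<Sum>i\<le>n. of_nat (Suc i) *\<^sub>c ?t (Suc i)) = (\<Sum>i\<le>Suc n. of_nat i *\<^sub>c ?t i)"
      by (subst sum.atMost_Suc_shift) (simp add: xyscale_simps)
    also have "(\<Sum>i\<le>n. of_nat (Suc n - i) *\<^sub>c ?t i) = (\<Sum>i\<le>Suc n. of_nat (Suc n - i) *\<^sub>c ?t i)"
      by (simp add: xyscale_simps)
    also have "(\<Sum>i\<le>Suc n. of_nat i *\<^sub>c ?t i) + \<dots> = of_nat (Suc n) *\<^sub>c (\<Sum>i\<le>Suc n. ?t i)"
      unfolding sum.distrib[symmetric] xyscale_sum_right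
      by (rule sum.cong[OF refl]) (simp add: xyscale_simps(2)[symmetric] flip: of_nat_add del: of_nat_Suc)
    finally have "(1 / of_nat (Suc n)) *\<^sub>c of_nat (Suc n) *\<^sub>c e (Suc n) (b F G) =
        (1 / of_nat (Suc n)) *\<^sub>c of_nat (Suc n) *\<^sub>c (\<Sum>i\<le>Suc n. ?t i)" by simp
    then show ?case by (simp add: xyscale_simps del: of_nat_Suc sum.atMost_Suc)
  qed
  have "b (opexp V F) (opexp V G) = infsum (\<lambda>i. infsum (\<lambda>j. b (e i F) (e j G)) UNIV) UNIV"
    unfolding opexp_eq_infsum[OF V(2)] e_def[symmetric]
    by (simp only: cont_linear_infsum(2)[OF b(2) lf_e]) (simp only: cont_linear_infsum(2)[OF b(1) lf_e])
  also have "\<dots> = infsum (\<lambda>n. e n (b F G)) UNIV"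
    unfolding infsum_locally_finite_diagonal[OF lf] diag ..
  finally show ?thesis unfolding opexp_eq_infsum[OF V(2)] e_def by simp
qed

lemma vanish_ham_vf: "vanish M F \<Longrightarrow> vanish N G \<Longrightarrow> vanish (M + N - 2) (ham_vf F G)"
  unfolding ham_vf_def
proof (intro vanish_sum vanish_diff)
  fix i assume F: "vanish M F" and G: "vanish N G"
  show "vanish (M + N - 2) (dx i F * dy i G)" "vanish (M + N - 2) (dy i F * dx i G)"
    using vanish_mult[of "M - 1" "dx i F" "N - 1" "dy i G"] vanish_mult[of "M - 1" "dy i F" "N - 1" "dx i G"]
      vanish_partial[OF F, of i] vanish_partial[OF G, of i] by (auto elim: vanish_mono)
qed

text \<open>
  By Jacobi, \<open>ham_vf S\<close> is a derivation of the bracket, so its exponential is an automorphism of the bracket.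
\<close>

lemma opexp_conjugate_ham_vf:
  assumes "vanish 3 S"
  shows "opexp (ham_vf S) \<circ> ham_vf G \<circ> opexp (\<lambda>F. - ham_vf S F) = ham_vf (opexp (ham_vf S) G)"
proof
  fix F
  have V: "cont_linear (ham_vf S)" "raises 1 (ham_vf S)"
    using raises_ham_vf[of 1 S] assms by (simp_all add: cont_linear_ham_vf eval_nat_numeral)
  have "opexp (ham_vf S) (ham_vf G K) = ham_vf (opexp (ham_vf S) G) (opexp (ham_vf S) K)" for K
    by (rule opexp_pairing[OF V, where b = ham_vf and d = 2])
       (auto intro: cont_linear_ham_vf cont_linear_ham_vf_left vanish_ham_vf ham_vf_jacobi)
  then show "(opexp (ham_vf S) \<circ> ham_vf G \<circ> opexp (\<lambda>F. - ham_vf S F)) F = ham_vf (opexp (ham_vf S) G) F"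
    by (simp add: opexp_inverse[OF V])
qed

section \<open>Composition powers of the mould Sam\<close>

lemma sum_list_concat: "sum_list (map sum_list us) = sum_list (concat us)"
  for us :: "'a::comm_monoid_add list list"
  by (induction us) auto

text \<open>Cutting the image word at certain places cuts the original word at the same places. With
  \<open>concat_map_inject\<close> this lift is unique, as the block lengths are known.\<close>

lemma map_eq_concat:
  "map f us = concat vss \<Longrightarrow> \<exists>ts. concat ts = us \<and> map (map f) ts = vss"
proof (induction vss arbitrary: us)
  case (Cons v vss)
  then obtain u u' where u: "us = u @ u'" "map f u = v" "map f u' = concat vss"
    by (auto simp: map_eq_append_conv)
  then obtain ts where "concat ts = u'" "map (map f) ts = vss" using Cons.IH by blast
  then show ?case using u by (intro exI[of _ "u # ts"]) simp
qed simp

lemma concat_map_inject: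
  "concat ts = concat ts' \<Longrightarrow> map (map f) ts = map (map f) ts' \<Longrightarrow> ts = ts'"
proof (induction ts arbitrary: ts')
  case (Cons t ts)
  then obtain t' ts'' where ts': "ts' = t' # ts''" by (cases ts') auto
  then have "length t = length t'" using Cons.prems by (metis length_map list.inject list.map(2))
  then show ?case using Cons ts' by simp
qed simp

text \<open>Distributivity: choosing one factorization for each entry of us is choosing a list of
  factorizations. Finiteness is proved alongside because the sums are taken over these sets.\<close>

lemma finite_map_concat: "finite {ts. map concat ts = us \<and> (\<forall>t\<in>set ts. [] \<notin> set t)}"
  and prod_list_sum_factorizations:
  "prod_list (map (\<lambda>u. \<Sum>t | concat t = u \<and> [] \<notin> set t. f t) us) =
     (\<Sum>ts | map concat ts = us \<and> (\<forall>t\<in>set ts. [] \<notin> set t). prod_list (map f ts))"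
  for f :: "complex list list \<Rightarrow> complex"
proof (induction us)
  case Nil
  have eq: "{ts. map concat ts = [] \<and> (\<forall>t\<in>set ts. [] \<notin> set (t :: complex list list))} = {[]}" by auto
  {
    case 1
    show ?case unfolding eq by simp
  next
    case 2
    show ?case unfolding eq by simp
  }
next
  case (Cons u us)
  let ?R = "\<lambda>us. {ts. map concat ts = us \<and> (\<forall>t\<in>set ts. [] \<notin> set (t :: complex list list))}"
  let ?S = "{t. concat t = u \<and> [] \<notin> set (t :: complex list list)}"
  have eq: "?R (u # us) = (\<lambda>(t, ts). t # ts) ` (?S \<times> ?R us)"
    by (auto simp: map_eq_Cons_conv)
  have inj: "inj_on (\<lambda>(t, ts). t # ts) (?S \<times> ?R us)" by (auto simp: inj_on_def)
  {
    case 1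
    show ?case unfolding eq using Cons.IH(1) finite_factorizations by blast
  next
    case 2
    show ?case
      unfolding eq sum.reindex[OF inj] using Cons.IH(2)
      by (simp add: sum_product sum.cartesian_product case_prod_unfold)
  }
qed

text \<open>Both sides are sums over the factorizations of \<open>w\<close> into blocks of blocks.\<close>

lemma mould_comp_assoc:
  fixes M N P :: mould
  shows "(M \<circ>\<^sub>m N) \<circ>\<^sub>m P = M \<circ>\<^sub>m (N \<circ>\<^sub>m P)"
proof
  fix w :: "complex list"
  define S where "S w = {us. concat us = w \<and> [] \<notin> set us}" for w :: "complex list"
  define R where "R us = {ts. map concat ts = us \<and> (\<forall>t\<in>set ts. [] \<notin> set t)}" for us :: "complex list list"
  define T where "T = {ts. concat (concat ts) = w \<and> [] \<notin> set ts \<and> [] \<notin> set (concat ts)}"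
  let ?NP = "\<lambda>t. N (map sum_list t) * prod_list (map P t)"
  let ?c = "\<lambda>ts. M (map (sum_list \<circ> concat) ts) * prod_list (map ?NP ts)"
  have finS: "finite (S w)" and finR: "finite (R us)" for w us
    by (simp_all add: S_def R_def finite_factorizations finite_map_concat)
  have prod: "prod_list (map ?NP ts) = prod_list (map (\<lambda>t. N (map sum_list t)) ts) * prod_list (map P (concat ts))" for ts
    by (induction ts) (simp_all add: mult_ac)
  have "((M \<circ>\<^sub>m N) \<circ>\<^sub>m P) w = (\<Sum>us\<in>S w. \<Sum>vss\<in>S (map sum_list us).
      M (map sum_list vss) * prod_list (map N vss) * prod_list (map P us))"
    by (simp add: mould_comp_eq S_def sum_distrib_right)
  also have "\<dots> = (\<Sum>(us, vss)\<in>Sigma (S w) (\<lambda>us. S (map sum_list us)).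
      M (map sum_list vss) * prod_list (map N vss) * prod_list (map P us))"
    by (subst sum.Sigma) (simp_all add: finS)
  \<comment> \<open>A block of blocks yields its flattening together with the block sums; conversely
    a factorization of the word of sums lifts to one of us.\<close>
  also have "Sigma (S w) (\<lambda>us. S (map sum_list us)) = (\<lambda>ts. (concat ts, map (map sum_list) ts)) ` T"
  proof (intro equalityI subsetI)
    fix x assume "x \<in> Sigma (S w) (\<lambda>us. S (map sum_list us))"
    then obtain us vss where x: "x = (us, vss)" "concat us = w" "[] \<notin> set us"
      "concat vss = map sum_list us" "[] \<notin> set vss" by (auto simp: S_def)
    then obtain ts where "concat ts = us" "map (map sum_list) ts = vss" using map_eq_concat by metis
    then show "x \<in> (\<lambda>ts. (concat ts, map (map sum_list) ts)) ` T"
      using x by (intro image_eqI[of _ _ ts]) (auto simp: T_def)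
  qed (auto simp: S_def T_def map_concat)
  also have "(\<Sum>(us, vss)\<in>(\<lambda>ts. (concat ts, map (map sum_list) ts)) ` T.
      M (map sum_list vss) * prod_list (map N vss) * prod_list (map P us)) = (\<Sum>ts\<in>T. ?c ts)"
  proof (subst sum.reindex)
    show "inj_on (\<lambda>ts. (concat ts, map (map sum_list) ts)) T"
      by (auto intro!: inj_onI dest: concat_map_inject)
  qed (simp add: prod sum_list_concat o_def mult.assoc)
  also have "\<dots> = (\<Sum>(us, ts)\<in>(\<lambda>ts. (map concat ts, ts)) ` T. M (map sum_list us) * prod_list (map ?NP ts))"
    by (subst sum.reindex) (auto simp: inj_on_def)
  also have "(\<lambda>ts. (map concat ts, ts)) ` T = Sigma (S w) R"
  proof -
    have "concat (map concat ts) = concat (concat ts)" for ts :: "complex list list list"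
      by (induction ts) auto
    moreover have nil: "\<exists>u\<in>set t. u \<noteq> []" if "[] \<notin> set t" "t \<noteq> []" for t :: "complex list list"
      using that by (cases t) auto
    ultimately have "ts \<in> T \<longleftrightarrow> map concat ts \<in> S w \<and> ts \<in> R (map concat ts)" for ts
      by (auto simp: S_def R_def T_def image_iff intro!: nil)
    moreover have "us = map concat ts" if "ts \<in> R us" for us ts
      using that by (simp add: R_def)
    ultimately show ?thesis by auto
  qed
  also have "(\<Sum>(us, ts)\<in>Sigma (S w) R. M (map sum_list us) * prod_list (map ?NP ts)) =
      (\<Sum>us\<in>S w. \<Sum>ts\<in>R us. M (map sum_list us) * prod_list (map ?NP ts))"
    by (subst sum.Sigma) (simp_all add: finS finR)
  also have "\<dots> = (M \<circ>\<^sub>m (N \<circ>\<^sub>m P)) w"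
    unfolding mould_comp_eq prod_list_sum_factorizations
    by (simp add: sum_distrib_left S_def R_def)
  finally show "((M \<circ>\<^sub>m N) \<circ>\<^sub>m P) w = (M \<circ>\<^sub>m (N \<circ>\<^sub>m P)) w" .
qed

section \<open>Units for composition\<close>

lemma mould_comp_Nil [simp]: "((M :: mould) \<circ>\<^sub>m N) [] = M []"
  by (simp add: mould_comp_def)

lemma concat_singletons: "\<forall>u\<in>set us. length u = 1 \<Longrightarrow> us = map (\<lambda>x. [x]) (concat us)"
proof (induction us)
  case (Cons u us)
  then show ?case by (cases u) auto
qed simp

lemma mould_comp_I_right: "(M :: mould) \<circ>\<^sub>m mould_I = M"
proof
  fix w :: "complex list"
  let ?s = "map (\<lambda>x. [x]) w"
  have "prod_list (map mould_I us) = 0" if "concat us = w" "us \<noteq> ?s" for us :: "complex list list"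
    using concat_singletons[of us] that by (auto simp: prod_list_zero_iff image_iff mould_I_def)
  then have "(M \<circ>\<^sub>m mould_I) w = (\<Sum>us\<in>{?s}. M (map sum_list us) * prod_list (map mould_I us))"
    unfolding mould_comp_eq
    by (intro sum.mono_neutral_right[OF finite_factorizations]) (auto simp: o_def)
  moreover have "prod_list (map mould_I ?s) = 1"
    by (induction w) (simp_all add: mould_I_def)
  ultimately show "(M \<circ>\<^sub>m mould_I) w = M w" by (simp add: o_def)
qed

lemma mould_comp_I_left:
  fixes N :: mould
  assumes "N [] = 0"
  shows "mould_I \<circ>\<^sub>m N = N"
proof
  fix w :: "complex list"
  show "(mould_I \<circ>\<^sub>m N) w = N w"
  proof (cases "w = []")
    case False
    have "mould_I (map sum_list us) = 0" if "concat us = w" "us \<noteq> [w]" for us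
      using that by (auto simp: mould_I_def length_Suc_conv)
    then have "(mould_I \<circ>\<^sub>m N) w = (\<Sum>us\<in>{[w]}. mould_I (map sum_list us) * prod_list (map N us))"
      unfolding mould_comp_eq
      by (intro sum.mono_neutral_right[OF finite_factorizations]) (use False in auto)
    then show ?thesis by (simp add: mould_I_def)
  qed (simp add: assms mould_I_def)
qed

section \<open>Values of moulds on letters and on words of zeros\<close>

lemma mould_power_Nil: "M [] = 0 \<Longrightarrow> mould_power M k [] = (if k = 0 then 1 else 0)"
proof (cases k)
  case (Suc j)
  have "{(u, v). u @ v = []} = {([] :: complex list, [] :: complex list)}" by auto
  then show "M [] = 0 \<Longrightarrow> ?thesis" using Suc by (simp add: mould_mult_def)
qed (simp add: mould_one_def)

lemma mould_mult_single: "(M \<times>\<^sub>m N) [w] = M [] * N [w] + M [w] * N []"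
proof -
  have "{(u, v). u @ v = [w]} = {([], [w]), ([w], [])}" by (auto simp: append_eq_Cons_conv)
  then show ?thesis by (simp add: mould_mult_def)
qed

lemma mould_mult_Nil: "(M \<times>\<^sub>m N) [] = M [] * N []"
proof -
  have "{(u, v). u @ v = []} = {([] :: complex list, [] :: complex list)}" by auto
  then show ?thesis by (simp add: mould_mult_def)
qed

lemma mould_exp_Nil:
  assumes "M [] = 0" shows "mould_exp M [] = 1"
  unfolding mould_exp_def mould_power_Nil[of M, OF assms]
  by (subst suminf_finite[of "{0}"]) auto

lemma mould_exp_single:
  assumes "M [] = 0" shows "mould_exp M [w] = M [w]"
proof -
  have "mould_power M k [w] = (if k = 1 then M [w] else 0)" for k
    by (cases k) (simp_all add: mould_one_def mould_mult_single mould_power_Nil[of M, OF assms] assms)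
  then show ?thesis
    unfolding mould_exp_def by (subst suminf_finite[of "{1}"]) (auto simp del: mould_power.simps)
qed

lemma mould_exp_zeros:
  assumes M: "\<And>u. set u \<subseteq> {0} \<Longrightarrow> M u = 0" and ws: "set ws \<subseteq> {0}"
  shows "mould_exp M ws = mould_one ws"
proof (cases "ws = []")
  case True
  then show ?thesis using mould_exp_Nil[of M] M[of "[]"] by (simp add: mould_one_def)
next
  case False
  have "mould_power M k ws = 0" for k
  proof (cases k)
    case (Suc j)
    have "M u * mould_power M j v = 0" if "u @ v = ws" for u v
      using M[of u] ws that by auto
    then show ?thesis using Suc by (simp add: mould_mult_def case_prod_unfold sum.neutral)
  qed (simp add: mould_one_def False)
  then show ?thesis by (simp add: mould_exp_def mould_one_def False)
qed

lemma mould_V_zeros: "set u \<subseteq> {0} \<Longrightarrow> mould_V u = 0"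
  by (auto simp: mould_V_def split: list.split)

lemma Sam_Nil: "Sam [] = 0"
  by (simp add: Sam_def mould_mult_Nil mould_I_def mould_nabla_def)

text \<open>On a letter the conjugation contributes 1 and the \<nabla>-term contributes w times
  \<open>mould_V [w]\<close>; the value of \<open>mould_V\<close> makes these cancel for nonzero
  w.\<close>

lemma Sam_single: "Sam [w] = (if w = 0 then 1 else 0)"
  by (simp add: Sam_def mould_mult_Nil mould_mult_single mould_I_def mould_nabla_def
      mould_exp_Nil mould_exp_single mould_V_def)

lemma mould_mult_one_on:
  assumes "\<And>u v. u @ v = ws \<Longrightarrow> N v = mould_one v"
  shows "(M \<times>\<^sub>m N) ws = M ws"
proof -
  have N0: "N v = 0" if "ws = u @ v" "v \<noteq> []" for u v
    using assms[of u v] that by (simp add: mould_one_def)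
  have "(M \<times>\<^sub>m N) ws = (\<Sum>(u, v)\<in>{(ws, [])}. M u * N v)"
    unfolding mould_mult_def
    by (rule sum.mono_neutral_right[OF finite_splits]) (auto dest: N0)
  then show ?thesis using assms[of ws "[]"] by (simp add: mould_one_def)
qed

lemma mould_mult_one_on_left:
  assumes "\<And>u v. u @ v = ws \<Longrightarrow> M u = mould_one u"
  shows "(M \<times>\<^sub>m N) ws = N ws"
proof -
  have M0: "M u = 0" if "ws = u @ v" "u \<noteq> []" for u v
    using assms[of u v] that by (simp add: mould_one_def)
  have "(M \<times>\<^sub>m N) ws = (\<Sum>(u, v)\<in>{([], ws)}. M u * N v)"
    unfolding mould_mult_def
    by (rule sum.mono_neutral_right[OF finite_splits]) (auto dest: M0)
  then show ?thesis using assms[of "[]" ws] by (simp add: mould_one_def)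
qed

text \<open>\<open>mould_V\<close> vanishes on every subword, so both exponentials act as the unit,
  and \<nabla> multiplies by the sum 0.\<close>

lemma Sam_zeros:
  assumes "set ws \<subseteq> {0}"
  shows "Sam ws = mould_I ws"
proof -
  have E: "mould_exp mould_V u = mould_one u" "mould_exp (\<lambda>u. - mould_V u) u = mould_one u"
    if "set u \<subseteq> {0}" for u
    using that by (auto intro!: mould_exp_zeros simp: mould_V_zeros)
  have sub: "set u \<subseteq> {0}" "set v \<subseteq> {0}" if "u @ v = ws" for u v using that assms by auto
  have "(mould_exp mould_V \<times>\<^sub>m mould_I \<times>\<^sub>m mould_exp (\<lambda>u. - mould_V u)) ws =
      (mould_exp mould_V \<times>\<^sub>m mould_I) ws"
    by (rule mould_mult_one_on, rule E(2), erule sub(2))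
  moreover have "\<dots> = mould_I ws"
    by (rule mould_mult_one_on_left, rule E(1), erule sub(1))
  moreover have "(mould_nabla (mould_exp mould_V) \<times>\<^sub>m mould_exp (\<lambda>u. - mould_V u)) ws =
      mould_nabla (mould_exp mould_V) ws"
    by (rule mould_mult_one_on, rule E(2), erule sub(2))
  moreover have "mould_nabla (mould_exp mould_V) ws = 0"
    using E(1)[OF assms] by (cases ws) (auto simp: mould_nabla_def mould_one_def)
  ultimately show ?thesis by (simp add: Sam_def)
qed

text \<open>Powers grow on the left, as the simplification procedure does; the stability argument
  takes a factor off on the right.\<close>

lemma mould_compow_Suc_right:
  assumes "M [] = 0" shows "mould_compow M (Suc k) = mould_compow M k \<circ>\<^sub>m M"
proof (induction k)
  case 0
  then show ?case by (simp add: mould_comp_I_left mould_comp_I_right assms)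
next
  case (Suc k)
  have "mould_compow M (Suc (Suc k)) = M \<circ>\<^sub>m (mould_compow M k \<circ>\<^sub>m M)" using Suc by simp
  then show ?case by (simp add: mould_comp_assoc)
qed

text \<open>Among words of zeros \<open>Sam\<close> is nonzero only on single letters, so only the
  factorization into letters survives, and it returns the same word.\<close>

lemma Sam_compow_zeros:
  assumes "set ws \<subseteq> {0}"
  shows "mould_compow Sam k ws = mould_I ws"
proof (induction k)
  case (Suc k)
  let ?s = "map (\<lambda>x. [x]) ws"
  have "prod_list (map Sam us) = 0" if us: "concat us = ws" "us \<noteq> ?s" for us
  proof -
    obtain u where u: "u \<in> set us" "length u \<noteq> 1" using concat_singletons[of us] us by blast
    have "set u \<subseteq> set ws" using us(1) u(1) by auto
    then have "set u \<subseteq> {0}" using assms by blast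
    then have "Sam u = 0" using Sam_zeros u by (simp add: mould_I_def)
    then show ?thesis using u by (auto simp: prod_list_zero_iff image_iff)
  qed
  then have "(mould_compow Sam k \<circ>\<^sub>m Sam) ws =
      (\<Sum>us\<in>{?s}. mould_compow Sam k (map sum_list us) * prod_list (map Sam us))"
    unfolding mould_comp_eq
    by (intro sum.mono_neutral_right[OF finite_factorizations]) (auto simp: o_def)
  moreover have "prod_list (map Sam ?s) = 1"
    using assms by (induction ws) (simp_all add: Sam_single)
  ultimately show ?case
    unfolding mould_compow_Suc_right[where M = Sam, OF Sam_Nil] using Suc by (simp add: o_def)
qed simp

text \<open>
  In \<open>Sam\<^sup>k \<circ> Sam\<close> a word with a nonzero letter is only factorized into fewer blocks than letters,
  since \<open>Sam\<close> vanishes on nonzero letters; so stability passes from shorter words to longer ones.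
\<close>

lemma Sam_compow_stable:
  assumes "length ws \<le> k"
  shows "mould_compow Sam k ws = Tram ws"
  using assms
proof (induction "length ws" arbitrary: ws k rule: less_induct)
  case less
  show ?case
  proof (cases "set ws \<subseteq> {0}")
    case True
    then show ?thesis by (simp add: Sam_compow_zeros Tram_def mould_I_def)
  next
    case False
    then have ne: "ws \<noteq> []" by auto
    then obtain n where n: "length ws = Suc n" by (cases ws) auto
    obtain j where j: "k = Suc j" "n \<le> j" using less.prems n by (cases k) auto
    have short: "length us \<le> n" if us: "concat us = ws" "[] \<notin> set us" "prod_list (map Sam us) \<noteq> 0" for us
    proof (rule ccontr)
      assume "\<not> length us \<le> n"
      then have len: "length us = length (concat us)"
        using length_le_concat[OF us(2)] us(1) n by simp
      have "\<forall>u\<in>set us. length u = 1"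
        using len us(2)
      proof (induction us)
        case (Cons u us)
        then have ne: "[] \<notin> set us" and "length us \<le> length (concat us)" "1 \<le> length u" by (auto intro: length_le_concat simp: Suc_le_eq)
        then have u: "length u = 1" and us: "length us = length (concat us)" using Cons.prems(1)
          unfolding concat.simps length_append list.size by linarith+
        show ?case using Cons.IH[OF us ne] u by (metis set_ConsD)
      qed simp
      then have eq: "us = map (\<lambda>x. [x]) ws" using concat_singletons us(1) by blast
      obtain x where "x \<in> set ws" "x \<noteq> 0" using False by auto
      then have "Sam [x] = 0" "[x] \<in> set us" using eq by (auto simp: Sam_single)
      then show False using us(3) by (auto simp: prod_list_zero_iff image_iff)
    qed
    \<comment> \<open>Both j and n are at least the length of the word of block sums whenever the
      product is nonzero, so by induction both powers agree with \<open>Tram\<close> there.\<close>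
    have "mould_compow Sam (Suc j) ws = mould_compow Sam (Suc n) ws"
      unfolding mould_compow_Suc_right[where M = Sam, OF Sam_Nil] mould_comp_eq
    proof (rule sum.cong[OF refl])
      fix us assume us: "us \<in> {us. concat us = ws \<and> [] \<notin> set us}"
      show "mould_compow Sam j (map sum_list us) * prod_list (map Sam us) =
          mould_compow Sam n (map sum_list us) * prod_list (map Sam us)"
      proof (cases "prod_list (map Sam us) = 0")
        case False
        then have "length us \<le> n" using short us by blast
        then show ?thesis using less.hyps[of "map sum_list us" j] less.hyps[of "map sum_list us" n] n j by simp
      qed simp
    qed
    then show ?thesis using ne n j by (simp add: Tram_def)
  qed
qed

section \<open>The simplification procedure\<close>

lemma raises_component:
  assumes "w \<notin> weight lam ` {k. mdeg k < N + 2}"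
  shows "raises N (ham_vf (component lam G w))"
  using assms by (intro raises_ham_vf) (auto simp: vanish_def xycoeff_component)

text \<open>A component starts in degree 3 and hence gains one degree. A weight that does not occur
  below degree N + 2 gains N, and only finitely many weights occur there.\<close>

lemma letter_ops_component: "letter_ops (\<lambda>w. ham_vf (component lam G w))"
proof
  fix w N
  show "cont_linear (ham_vf (component lam G w))" by (rule cont_linear_ham_vf)
  show "raises 1 (ham_vf (component lam G w))"
    using raises_ham_vf[of 1 "component lam G w"] vanish_component[of lam G w]
    by (simp add: eval_nat_numeral)
  show "finite {w. \<not> raises N (ham_vf (component lam G w))}"
    by (rule finite_subset[OF _ finite_imageI[OF finite_mdeg_less[of "N + 2"], of "weight lam"]])
       (use raises_component in blast)
qed

section \<open>Uniqueness of weight-homogeneous parts\<close>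

lemma cont_linear_weight_part: "cont_linear (weight_part lam \<alpha>)"
  unfolding cont_linear_def
  by (intro conjI allI) (auto intro!: xyseries_eqI simp: xycoeff_weight_part vanish_def)

lemma homogeneous_infsum:
  assumes "\<And>i. i \<in> A \<Longrightarrow> homogeneous lam w (L i)" and "\<And>F. locally_finite (\<lambda>i. c i *\<^sub>c L i F) A"
  shows "homogeneous lam w (\<lambda>F. infsum (\<lambda>i. c i *\<^sub>c L i F) A)"
  unfolding homogeneous_def
proof (intro allI)
  fix \<alpha> F
  have "infsum (\<lambda>i. c i *\<^sub>c L i (weight_part lam \<alpha> F)) A =
      infsum (\<lambda>i. weight_part lam (\<alpha> + w) (c i *\<^sub>c L i F)) A"
    using assms(1) by (intro infsum_cong) (simp add: homogeneous_def cont_linear_scale[OF cont_linear_weight_part])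
  then show "infsum (\<lambda>i. c i *\<^sub>c L i (weight_part lam \<alpha> F)) A =
      weight_part lam (\<alpha> + w) (infsum (\<lambda>i. c i *\<^sub>c L i F) A)"
    by (simp add: cont_linear_infsum(2)[OF cont_linear_weight_part assms(2)])
qed

text \<open>
  A homogeneous component of an operator is recovered from the operator by restricting the argument to
  the one weight that it moves into the weight of \<open>k\<close>.
\<close>

lemma xycoeff_homogeneous_part:
  assumes "\<And>v. homogeneous lam v (L v)" and "\<And>F. locally_finite (\<lambda>v. L v F) UNIV"
  shows "xycoeff (L w F) k =
         xycoeff (infsum (\<lambda>v. L v (weight_part lam (weight lam k - w) F)) UNIV) k"
proof -
  have part: "xycoeff (L v (weight_part lam (weight lam k - w) F)) k =
      (if v = w then xycoeff (L w F) k else 0)" for v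
    using assms(1)[of v] by (simp add: homogeneous_def xycoeff_weight_part)
  show ?thesis
    by (subst xycoeff_infsum_sum[OF assms(2), where T = "{w}"]) (simp_all add: part)
qed

lemma homogeneous_parts_unique:
  assumes "\<And>v. homogeneous lam v (L v)" "\<And>F. locally_finite (\<lambda>v. L v F) UNIV"
    and "\<And>v. homogeneous lam v (L' v)" "\<And>F. locally_finite (\<lambda>v. L' v F) UNIV"
    and "\<And>F. infsum (\<lambda>v. L v F) UNIV = infsum (\<lambda>v. L' v F) UNIV"
  shows "L w F = L' w F"
  by (rule xyseries_eqI) (simp add: xycoeff_homogeneous_part[OF assms(1,2)] xycoeff_homogeneous_part[OF assms(3,4)] assms(5))

lemma homogeneous_words:
  assumes "\<And>w. homogeneous lam w (D w)"
  shows "homogeneous lam (sum_list ws) (words D ws)"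
proof (induction ws)
  case (Cons w ws)
  then show ?case
    unfolding words_Cons sum_list.Cons by (intro homogeneous_comp assms)
qed (simp add: homogeneous_def)

context letter_ops
begin

lemma contract_letters:
  assumes "\<And>ws. length ws \<noteq> 1 \<Longrightarrow> M ws = 0"
  shows "contract D M F = infsum (\<lambda>w. M [w] *\<^sub>c D w F) UNIV"
proof -
  have "M ws = 0" if "ws \<notin> range (\<lambda>w. [w])" for ws
    using that assms[of ws] by (auto simp: length_Suc_conv image_iff)
  then have "contract D M F = infsum (\<lambda>ws. M ws *\<^sub>c words D ws F) (range (\<lambda>w. [w]))"
    unfolding contract_def by (intro infsum_cong_neutral) (auto simp: xyscale_simps)
  then show ?thesis by (simp add: infsum_reindex inj_on_def o_def)
qed

lemma contract_add: "contract D M (F + G) = contract D M F + contract D M G"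
  unfolding contract_def
  by (simp add: cont_linear_add[OF cont_linear_words] xyscale_simps infsum_locally_finite_add locally_finite_words')

lemma contract_sum_list:
  "locally_finite (\<lambda>w. infsum (\<lambda>ws. M ws *\<^sub>c words D ws F) {ws. sum_list ws = w}) UNIV"
  "infsum (\<lambda>w. infsum (\<lambda>ws. M ws *\<^sub>c words D ws F) {ws. sum_list ws = w}) UNIV = contract D M F"
  using infsum_locally_finite_fibres[OF locally_finite_words'[of M F UNIV], of sum_list UNIV]
  by (simp_all add: contract_def)

lemma words_zero_letter: "w \<in> set ws \<Longrightarrow> (\<And>F. D w F = 0) \<Longrightarrow> words D ws F = 0"
  by (induction ws) (auto simp: cont_linear_zero[OF cont_linear_letter])

text \<open>A word longer than the degree of k cannot reach coefficient k, so agreement on short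
  words suffices there.\<close>

lemma contract_cong_degree:
  assumes "\<And>ws. length ws \<le> mdeg k \<Longrightarrow> M ws = N ws"
  shows "xycoeff (contract D M F) k = xycoeff (contract D N F) k"
proof -
  have eq: "M ws * xycoeff (words D ws F) k = N ws * xycoeff (words D ws F) k" for ws
  proof (cases "length ws \<le> mdeg k")
    case False
    have "vanish (0 + length ws) (words D ws F)"
      by (rule raisesD[OF raises_words_length vanish_0(1)])
    then have "xycoeff (words D ws F) k = 0" using False by (simp add: vanishD)
    then show ?thesis by simp
  qed (simp add: assms)
  show ?thesis
    unfolding contract_def xycoeff_infsum[OF locally_finite_words'] xycoeff_scale eq ..
qed

end

section \<open>One simplification step\<close>

definition simp_ham :: "complex^'v::finite \<Rightarrow> 'v xyseries \<Rightarrow> 'v xyseries" where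
  "simp_ham lam G = infsum (\<lambda>w. mould_V [w] *\<^sub>c component lam G w) UNIV"

lemma vanish_simp_ham: "vanish 3 (simp_ham lam G)"
  by (simp add: vanish_def simp_ham_def xycoeff_infsum_component)

lemma ham_vf_simp_ham:
  "ham_vf (simp_ham lam G) F = infsum (\<lambda>w. mould_V [w] *\<^sub>c ham_vf (component lam G w) F) UNIV"
  unfolding simp_ham_def cont_linear_infsum(2)[OF cont_linear_ham_vf_left locally_finite_scale[OF locally_finite_component]]
    cont_linear_scale[OF cont_linear_ham_vf_left] ..

lemma ham_vf_zero: "ham_vf 0 F = 0"
  by (rule cont_linear_zero[OF cont_linear_ham_vf_left])

text \<open>\<open>mould_V [w]\<close> is 0 at w = 0 and components vanish off \<Omega>, so the sum
  over nonzero letters of \<Omega> extends to all weights.\<close>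

lemma simp_gen_eq:
  assumes "formal_hamiltonian lam \<Omega> G"
  shows "simp_gen lam \<Omega> G = ham_vf (simp_ham lam G)"
proof
  fix F
  have "component lam G w = 0" if "w \<notin> \<Omega>" for w
    using assms that by (auto simp: formal_hamiltonian_def)
  then show "simp_gen lam \<Omega> G F = ham_vf (simp_ham lam G) F"
    unfolding simp_gen_def ham_vf_simp_ham
    by (intro infsum_cong_neutral) (auto simp: mould_V_def xyscale_simps ham_vf_zero)
qed

lemma ham_vf_decompose:
  assumes "\<And>k. mdeg k < 3 \<Longrightarrow> xycoeff G k = xycoeff (quad_ham lam) k"
  shows "ham_vf G F = X_lin lam F + infsum (\<lambda>w. ham_vf (component lam G w) F) UNIV"
proof -
  have "G = quad_ham lam + infsum (\<lambda>w. component lam G w) UNIV"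
  proof (rule xyseries_eqI)
    fix k
    have "xycoeff (quad_ham lam) k = 0" if "\<not> mdeg k < 3"
      using that by (intro xycoeff_quad_ham) simp
    then show "xycoeff G k = xycoeff (quad_ham lam + infsum (\<lambda>w. component lam G w) UNIV) k"
      using xycoeff_infsum_component[of "\<lambda>_. 1" lam G k] assms by (auto simp: xyscale_simps)
  qed
  then have "ham_vf G F = ham_vf (quad_ham lam + infsum (\<lambda>w. component lam G w) UNIV) F" by simp
  also have "\<dots> = X_lin lam F + infsum (\<lambda>w. ham_vf (component lam G w) F) UNIV"
    using cont_linear_add[OF cont_linear_ham_vf_left] cont_linear_infsum(2)[OF cont_linear_ham_vf_left locally_finite_component]
    by (metis ham_vf_quad_ham)
  finally show ?thesis .
qed

lemma cont_linear_X_lin: "cont_linear (X_lin lam)"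
  unfolding ham_vf_quad_ham[symmetric] by (rule cont_linear_ham_vf)

context
  fixes lam :: "complex^'v::finite" and \<Omega> :: "complex set" and G G' :: "'v xyseries"
  assumes formal: "formal_hamiltonian lam \<Omega> G"
    and Omega_add: "\<And>u v. u \<in> \<Omega> \<Longrightarrow> v \<in> \<Omega> \<Longrightarrow> u + v \<in> \<Omega>"
  defines "G' \<equiv> opexp (ham_vf (simp_ham lam G)) G"
begin

lemma low_degree: "mdeg k < 3 \<Longrightarrow> xycoeff G k = xycoeff (quad_ham lam) k"
  using formal by (simp add: formal_hamiltonian_def)

lemma raises_simp_ham: "raises 1 (ham_vf (simp_ham lam G))"
  using raises_ham_vf[of 1 "simp_ham lam G"] vanish_simp_ham[of lam G] by (simp add: eval_nat_numeral)

lemma simp_vf_eq: "simp_vf lam \<Omega> (ham_vf G) = ham_vf G'"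
proof -
  have "(THE K. formal_hamiltonian lam \<Omega> K \<and> ham_vf K = ham_vf G) = G"
  proof (rule the_equality)
    fix K assume K: "formal_hamiltonian lam \<Omega> K \<and> ham_vf K = ham_vf G"
    then have "xycoeff K 0 = xycoeff G 0" using low_degree[of 0] by (simp add: formal_hamiltonian_def)
    then show "K = G" using K ham_vf_inj by blast
  qed (use formal in simp)
  then show ?thesis
    by (simp add: simp_vf_def simp_gen_eq[OF formal] G'_def Let_def
        opexp_conjugate_ham_vf[OF vanish_simp_ham])
qed

text \<open>G starts in degree 2 and the generator raises degrees, so only the zeroth term of the
  exponential is seen below degree 3.\<close>

lemma low_degree_simplified: "mdeg k < 3 \<Longrightarrow> xycoeff G' k = xycoeff (quad_ham lam) k"
proof -
  assume k: "mdeg k < 3"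
  let ?V = "ham_vf (simp_ham lam G)"
  have G: "vanish 2 G"
    unfolding vanish_def by (auto simp: low_degree xycoeff_quad_ham)
  have "xycoeff ((?V ^^ n) G) k = 0" if "n \<noteq> 0" for n
    using vanishD[OF raisesD[OF raises_funpow[OF raises_simp_ham, of n] G], of k] k that by simp
  then have "xycoeff G' k = (\<Sum>n\<in>{0}. xycoeff ((1 / fact n) *\<^sub>c (?V ^^ n) G) k)"
    unfolding G'_def opexp_eq_infsum[OF raises_simp_ham]
    by (intro xycoeff_infsum_sum) (simp_all add: locally_finite_opexp[OF raises_simp_ham])
  then show ?thesis by (simp add: low_degree k)
qed

text \<open>Pulling \<open>X_lin\<close> out to the left of the first exponential costs a
  \<nabla>-term, and the two exponentials then cancel in front of F. This is where the second
  summand of \<open>Sam\<close> comes from.\<close>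

lemma ham_vf_simplified:
  "ham_vf G' F = X_lin lam F + contract (\<lambda>w. ham_vf (component lam G w)) Sam F"
proof -
  define D where "D w = ham_vf (component lam G w)" for w
  interpret letter_ops D
    unfolding D_def by (rule letter_ops_component)
  let ?S = "simp_ham lam G" and ?V' = "\<lambda>u. - mould_V u"
  \<comment> \<open>K is F after the inner exponential, so that the outer exponential maps K back to
    F.\<close>
  define K where "K = contract D (mould_exp ?V') F"
  have V_Nil: "mould_V [] = 0" by (simp add: mould_V_def)
  have "mould_V ws = 0" if "length ws \<noteq> 1" for ws
    using that by (auto simp: mould_V_def split: list.splits)
  then have S: "ham_vf ?S = contract D mould_V"
    by (intro ext) (simp add: contract_letters ham_vf_simp_ham D_def)
  then have S': "(\<lambda>F. - ham_vf ?S F) = contract D ?V'"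
    by (simp add: contract_minus fun_eq_iff)
  have G: "ham_vf G K = X_lin lam K + contract D mould_I K"
    using ham_vf_decompose[of G lam K] low_degree
    by (subst contract_letters) (auto simp: mould_I_def D_def xyscale_simps)
  have inv: "contract D (mould_exp mould_V) K = F"
    using opexp_inverse[OF cont_linear_ham_vf raises_simp_ham, of F]
    unfolding S' unfolding S contract_exp[of mould_V, OF V_Nil] K_def
    by (simp add: contract_exp V_Nil)
  have nab: "X_lin lam (contract D M F) = contract D (mould_nabla M) F + contract D M (X_lin lam F)" for M F
    by (rule contract_nabla[OF cont_linear_X_lin]) (simp add: D_def X_lin_commute_component)
  have "ham_vf G' F = (opexp (ham_vf ?S) \<circ> ham_vf G \<circ> opexp (\<lambda>F. - ham_vf ?S F)) F"
    by (simp only: opexp_conjugate_ham_vf[OF vanish_simp_ham] G'_def)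
  also have "\<dots> = contract D (mould_exp mould_V) (ham_vf G K)"
    unfolding S' unfolding S by (simp add: contract_exp V_Nil K_def)
  also have "\<dots> = contract D (mould_exp mould_V) (X_lin lam K) +
      contract D (mould_exp mould_V) (contract D mould_I K)"
    by (simp add: G contract_add)
  also have "contract D (mould_exp mould_V) (X_lin lam K) =
      X_lin lam F - contract D (mould_nabla (mould_exp mould_V)) K"
    using nab[of "mould_exp mould_V" K] by (simp add: inv)
  also have "X_lin lam F - contract D (mould_nabla (mould_exp mould_V)) K +
      contract D (mould_exp mould_V) (contract D mould_I K) = X_lin lam F + contract D Sam F"
    by (simp add: Sam_def contract_diff contract_mult K_def)
  finally show ?thesis by (simp add: D_def[abs_def])
qed

text \<open>Both sides are the weight-w part of the new field without \<open>X_lin\<close>: the left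
  by the choice of components, the right because a word acts with the weight given by its
  sum.\<close>

lemma component_simplified:
  "ham_vf (component lam G' w) F =
     infsum (\<lambda>ws. Sam ws *\<^sub>c words (\<lambda>w. ham_vf (component lam G w)) ws F) {ws. sum_list ws = w}"
proof -
  let ?D = "\<lambda>w. ham_vf (component lam G w)"
  interpret letter_ops ?D by (rule letter_ops_component)
  have lf: "locally_finite (\<lambda>ws. Sam ws *\<^sub>c words ?D ws F) A" for A F by (rule locally_finite_words')
  have "homogeneous lam w (\<lambda>F. infsum (\<lambda>ws. Sam ws *\<^sub>c words ?D ws F) {ws. sum_list ws = w})" for w
  proof (rule homogeneous_infsum[OF _ lf])
    fix ws :: "complex list" assume "ws \<in> {ws. sum_list ws = w}"
    then show "homogeneous lam w (words ?D ws)"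
      using homogeneous_words[of lam ?D ws] homogeneous_component by auto
  qed
  moreover have "locally_finite (\<lambda>w. ham_vf (component lam G' w) F) UNIV" for F
    using cont_linear_infsum(1)[OF cont_linear_ham_vf_left locally_finite_component] .
  moreover have "infsum (\<lambda>w. ham_vf (component lam G' w) F) UNIV = contract ?D Sam F" for F
    using ham_vf_simplified[of F] ham_vf_decompose[of G' lam F] low_degree_simplified by simp
  ultimately show ?thesis
    by (intro homogeneous_parts_unique[where L = "\<lambda>w. ham_vf (component lam G' w)" and lam = lam])
       (simp_all add: homogeneous_component contract_sum_list)
qed

text \<open>By closure under addition, a nonempty word with sum outside \<Omega> has a letter
  outside \<Omega> and acts as 0; on the empty word \<open>Sam\<close> is 0. A component whose field
  vanishes is itself 0.\<close>

lemma formal_simplified: "formal_hamiltonian lam \<Omega> G'"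
  unfolding formal_hamiltonian_def
proof (intro conjI allI impI)
  fix w
  let ?D = "\<lambda>w. ham_vf (component lam G w)"
  interpret letter_ops ?D by (rule letter_ops_component)
  assume nz: "component lam G' w \<noteq> 0"
  show "w \<in> \<Omega>"
  proof (rule ccontr)
    assume w: "w \<notin> \<Omega>"
    have closed: "ws \<noteq> [] \<Longrightarrow> set ws \<subseteq> \<Omega> \<Longrightarrow> sum_list ws \<in> \<Omega>" for ws
      by (induction ws rule: induct_list012) (auto intro: Omega_add)
    have "Sam ws *\<^sub>c words ?D ws F = 0" if ws: "sum_list ws = w" for ws F
    proof (cases "ws = []")
      case False
      then obtain v where v: "v \<in> set ws" "v \<notin> \<Omega>" using closed[of ws] ws w by blast
      then have "component lam G v = 0" using formal by (auto simp: formal_hamiltonian_def)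
      then have "words ?D ws F = 0" using v(1) by (intro words_zero_letter) (auto simp: ham_vf_zero)
      then show ?thesis by (simp add: xyscale_simps)
    qed (simp add: Sam_Nil xyscale_simps)
    then have "ham_vf (component lam G' w) F = ham_vf 0 F" for F
      unfolding component_simplified ham_vf_zero by (intro infsum_0) simp
    then have "component lam G' w = 0"
      by (intro ham_vf_inj) (simp_all add: fun_eq_iff xycoeff_component)
    then show False using nz by simp
  qed
qed (rule low_degree_simplified)

end

section \<open>Iteration and passage to the limit\<close>

lemma formal_hamiltonian_hamiltonian:
  assumes "\<And>k. k \<in> A \<Longrightarrow> 3 \<le> mdeg k"
  shows "formal_hamiltonian lam (alphabet lam A) (hamiltonian lam A a)"
proof -
  have coeff: "xycoeff (hamiltonian lam A a) k = xycoeff (quad_ham lam) k + (if k \<in> A then a k else 0)" for k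
    by (simp add: hamiltonian_def)
  have "w \<in> alphabet lam A" if nz: "component lam (hamiltonian lam A a) w \<noteq> 0" for w
  proof -
    obtain k where k: "xycoeff (component lam (hamiltonian lam A a) w) k \<noteq> 0"
      using nz xyseries_eqI[of "component lam (hamiltonian lam A a) w" 0] by auto
    then have "3 \<le> mdeg k" "weight lam k = w" "xycoeff (hamiltonian lam A a) k \<noteq> 0"
      by (auto simp: xycoeff_component split: if_splits)
    then have "k \<in> A" using xycoeff_quad_ham[of k lam] by (auto simp: coeff split: if_splits)
    then show ?thesis using \<open>weight lam k = w\<close> by (auto simp: alphabet_def)
  qed
  moreover have "xycoeff (hamiltonian lam A a) k = xycoeff (quad_ham lam) k" if "mdeg k < 3" for k
    using that assms[of k] by (auto simp: coeff)
  ultimately show ?thesis by (simp add: formal_hamiltonian_def)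
qed

text \<open>The invariant records every component, not just the whole field, since the next step
  treats the components as its letters. Substituting them puts a further \<open>Sam\<close> on the
  outside.\<close>

lemma simp_iter_components:
  assumes H: "formal_hamiltonian lam \<Omega> H"
    and Omega_add: "\<And>u v. u \<in> \<Omega> \<Longrightarrow> v \<in> \<Omega> \<Longrightarrow> u + v \<in> \<Omega>"
  defines "D \<equiv> \<lambda>w. ham_vf (component lam H w)"
  shows "\<exists>G. formal_hamiltonian lam \<Omega> G \<and> simp_iter lam \<Omega> (ham_vf H) k = ham_vf G \<and>
    (\<forall>w F. ham_vf (component lam G w) F =
       infsum (\<lambda>ws. mould_compow Sam k ws *\<^sub>c words D ws F) {ws. sum_list ws = w})"
proof (induction k)
  case 0
  have eq: "D w F = infsum (\<lambda>ws. mould_I ws *\<^sub>c words D ws F) {ws. sum_list ws = w}" for w F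
  proof -
    have "infsum (\<lambda>ws. mould_I ws *\<^sub>c words D ws F) {ws. sum_list ws = w} =
        infsum (\<lambda>ws. mould_I ws *\<^sub>c words D ws F) {[w]}"
      by (rule infsum_cong_neutral) (auto simp: mould_I_def length_Suc_conv xyscale_simps)
    then show ?thesis by (simp add: mould_I_def xyscale_simps)
  qed
  show ?case
  proof (intro exI conjI allI)
    show "formal_hamiltonian lam \<Omega> H" by (rule H)
    show "simp_iter lam \<Omega> (ham_vf H) 0 = ham_vf H" by (simp add: simp_iter_def)
    show "ham_vf (component lam H w) F =
        infsum (\<lambda>ws. mould_compow Sam 0 ws *\<^sub>c words D ws F) {ws. sum_list ws = w}" for w F
      unfolding mould_compow.simps eq[symmetric] by (simp add: D_def)
  qed
next
  case (Suc k)
  interpret letter_ops D unfolding D_def by (rule letter_ops_component)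
  obtain G where G: "formal_hamiltonian lam \<Omega> G" "simp_iter lam \<Omega> (ham_vf H) k = ham_vf G"
    "\<And>w F. ham_vf (component lam G w) F =
       infsum (\<lambda>ws. mould_compow Sam k ws *\<^sub>c words D ws F) {ws. sum_list ws = w}"
    using Suc by blast
  have Nil: "mould_compow Sam k [] = 0" by (cases k) (simp_all add: mould_I_def Sam_Nil)
  let ?G' = "opexp (ham_vf (simp_ham lam G)) G"
  have "ham_vf (component lam ?G' w) F =
       infsum (\<lambda>ws. mould_compow Sam (Suc k) ws *\<^sub>c words D ws F) {ws. sum_list ws = w}" for w F
    using component_simplified[OF G(1) Omega_add, of w F]
      infsum_words_comp[where N = "mould_compow Sam k", OF Nil G(3), of Sam F w]
    by simp
  moreover have "simp_iter lam \<Omega> (ham_vf H) (Suc k) = ham_vf ?G'"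
    using simp_vf_eq[OF G(1) Omega_add] G(2) by (simp add: simp_iter_def)
  ultimately show ?case using formal_simplified[OF G(1) Omega_add] by blast
qed

lemma simp_iter_tendsto:
  assumes H: "formal_hamiltonian lam \<Omega> H"
    and Omega_add: "\<And>u v. u \<in> \<Omega> \<Longrightarrow> v \<in> \<Omega> \<Longrightarrow> u + v \<in> \<Omega>"
  defines "D \<equiv> \<lambda>w. ham_vf (component lam H w)"
  shows "(\<lambda>k. simp_iter lam \<Omega> (ham_vf H) k F) \<longlonglongrightarrow> X_lin lam F + contract D Tram F"
proof -
  interpret letter_ops D unfolding D_def by (rule letter_ops_component)
  have iter: "simp_iter lam \<Omega> (ham_vf H) k F = X_lin lam F + contract D (mould_compow Sam k) F" for k
  proof -
    obtain G where G: "formal_hamiltonian lam \<Omega> G" "simp_iter lam \<Omega> (ham_vf H) k = ham_vf G"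
      "\<And>w F. ham_vf (component lam G w) F =
         infsum (\<lambda>ws. mould_compow Sam k ws *\<^sub>c words D ws F) {ws. sum_list ws = w}"
      using simp_iter_components[OF H Omega_add, of k] unfolding D_def by blast
    then show ?thesis
      using ham_vf_decompose[of G lam F] by (simp add: formal_hamiltonian_def contract_sum_list)
  qed
  show ?thesis
    unfolding xyseries_tendsto_iff
  proof
    fix j
    show "\<forall>\<^sub>F k in sequentially. xycoeff (simp_iter lam \<Omega> (ham_vf H) k F) j =
        xycoeff (X_lin lam F + contract D Tram F) j"
      \<comment> \<open>From step \<open>mdeg j\<close> on, the moulds are stationary on all words
        short enough to reach coefficient j.\<close>
      using eventually_ge_at_top[of "mdeg j"]
    proof eventually_elim
      case (elim k)
      then have "xycoeff (contract D (mould_compow Sam k) F) j = xycoeff (contract D Tram F) j"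
        by (intro contract_cong_degree Sam_compow_stable) simp
      then show ?case by (simp add: iter)
    qed
  qed
qed

theorem theorem7p6:
  fixes lam :: "complex^'v::finite"
    and A :: "'v expo set"
    and a :: "'v expo \<Rightarrow> complex"
    and \<Omega> :: "complex set"
    and H :: "'v xyseries"
  assumes A_degree: "\<And>n m. (n, m) \<in> A \<Longrightarrow> 3 \<le> (\<Sum>i\<in>UNIV. n $ i) + (\<Sum>i\<in>UNIV. m $ i)"
    and H_eq: "H = hamiltonian lam A a"
    and Omega_eq: "\<Omega> = alphabet lam A"
    and Omega_add: "\<And>u v. u \<in> \<Omega> \<Longrightarrow> v \<in> \<Omega> \<Longrightarrow> u + v \<in> \<Omega>"
  shows "(\<forall>F. convergent (\<lambda>k. simp_iter lam \<Omega> (ham_vf H) k F)) \<and>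
         (\<forall>F. (\<lambda>ws. Tram ws *\<^sub>c word_op lam H ws F) summable_on lists \<Omega>) \<and>
         X_tram lam \<Omega> (ham_vf H) =
           (\<lambda>F. X_lin lam F + (\<Sum>\<^sub>\<infinity>ws\<in>lists \<Omega>. Tram ws *\<^sub>c word_op lam H ws F))"
proof -
  define D where "D w = ham_vf (component lam H w)" for w
  interpret letter_ops D unfolding D_def by (rule letter_ops_component)
  have "3 \<le> mdeg k" if "k \<in> A" for k
    using that A_degree[of "fst k" "snd k"] by (simp add: mdeg_def)
  then have H: "formal_hamiltonian lam \<Omega> H"
    unfolding H_eq Omega_eq by (rule formal_hamiltonian_hamiltonian)
  have words: "word_op lam H = words D"
    by (simp add: fun_eq_iff word_op_def words_def D_def)
  have lim: "(\<lambda>k. simp_iter lam \<Omega> (ham_vf H) k F) \<longlonglongrightarrow> X_lin lam F + contract D Tram F" for F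
    using simp_iter_tendsto[OF H Omega_add] by (simp add: D_def[abs_def])
  \<comment> \<open>A foreign letter carries the zero operator, so the contraction over all complex
    words is the sum over \<open>lists \<Omega>\<close>.\<close>
  have "words D ws F = 0" if "ws \<notin> lists \<Omega>" for ws F
  proof -
    obtain w where w: "w \<in> set ws" "w \<notin> \<Omega>" using \<open>ws \<notin> lists \<Omega>\<close> by auto
    then have "component lam H w = 0" using H by (auto simp: formal_hamiltonian_def)
    then show ?thesis using w(1) by (intro words_zero_letter) (auto simp: D_def ham_vf_zero)
  qed
  then have "contract D Tram F = (\<Sum>\<^sub>\<infinity>ws\<in>lists \<Omega>. Tram ws *\<^sub>c words D ws F)" for F
    unfolding contract_def by (intro infsum_cong_neutral) (auto simp: xyscale_simps)
  then show ?thesis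
    using lim by (auto simp: words convergent_def X_tram_def fun_eq_iff limI intro!: locally_finite_summable locally_finite_words')
qed

end
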